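(* Let $m\ge1$ and $n\ge k\ge0$ be integers. Then in $\hat{\mathbb Q}(\mathbf t)$ $$\mathbf S_{(m,1^k)}(1,t,t^2,\ldots,t^n)=\left[\begin{matrix} m+n \\ n-k\end{matrix}\right]_{q,t}\, r_{(1^k,m)}(q,t^{q^{n-k}}),$$ where $(m,1^k)$ is the hook partition with first part $m$ followed by $k$ ones, and $(1^k,m)$ is the composition of $m+k$ consisting of $k$ ones followed by $m$.
   Context: Ring: $\hat{\mathbb Q}(\mathbf t)$ is the field of rational functions over $\mathbb Q$ in algebraically independent indeterminates denoted $t^{q^r}$, $r\in\mathbb Z$ ($t=t^{q^0}$; $q$ formal). For $f(q)=\sum_rc_rq^r$ write $t^{f(q)}:=\prod_r(t^{q^r})^{c_r}$. The automorphism $\varphi$ sends $t^{q^r}\mapsto t^{q^{r+1}}$, and $F(q,t^{q^j}):=\varphi^jF(q,t)$. Put $N!_{q,t}:=\prod_{i=0}^{N-1}(1-t^{q^N-q^i})$, and $\left[\begin{smallmatrix} N \\ j\end{smallmatrix}\right]_{q,t}:=\frac{N!_{q,t}}{j!_{q,t}\,(N-j)!_{q,t^{q^j}}}$ for $0\le j\le N$. Schur analogue: for a partition $\lambda=(\lambda_1\ge\cdots\ge\lambda_N\ge0)$, $\mathbf S_\lambda(1,t,\ldots,t^{N-1}):=\det\big((t^{q^{\lambda_j+N-j}})^{i-1}\big)_{i,j=1}^N\big/\det\big((t^{q^{N-j}})^{i-1}\big)_{i,j=1}^N$. In the claim $N=n+1$. Ribbon number: for a composition $\alpha$ of $N$,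 $r_\alpha(q,t):=\sum_w\mathrm{wt}(w;q,t)$ over $w\in\mathfrak S_N$ whose descent composition (lengths of maximal increasing consecutive runs of $w(1),\ldots,w(N)$) equals $\alpha$. Weight: for a partition $\lambda$ inside a $p\times(N-p)$ rectangle, $u_\lambda\in\mathfrak S_N$ is the permutation increasing on $\{1,\ldots,p\}$ and on $\{p+1,\ldots,N\}$ with $u_\lambda(i)=\lambda_{p+1-i}+i$ for $i\le p$. For $w\in\mathfrak S_N$, $\mathrm{wt}(w;q,t)$ is $1$ if $N\le1$; otherwise let $w^{-1}(1)=p+1$ and factor uniquely $w=u_\lambda\cdot a\cdot e\cdot b$ (so $w(i)=u_\lambda(a(i))$ for $i\le p$, etc.) with $\lambda$ inside a $p\times(N-p)$ rectangle, $a\in\mathfrak S_{\{1,\ldots,p\}}\cong\mathfrak S_p$, $e$ the identity on $\{p+1\}$, $b\in\mathfrak S_{\{p+2,\ldots,N\}}\cong\mathfrak S_{N-p-1}$. Here $\lambda$ has exactly $p$ nonzero parts; with $\hat\lambda=(\lambda_1-1,\ldots,\lambda_p-1)$ inside a $p\times(N-1-p)$ rectangle and $u_{\hat\lambda}\in\mathfrak S_{N-1}$, set $$\mathrm{wt}(w;q,t):=t^{q^p-1}\frac{p!_{q,t^q}}{p!_{q,t}}\cdot\mathrm{wt}(u_{\hat\lambda};q,t^q)\,\mathrm{wt}(a;q,t)\,\mathrm{wt}(b;q,t^{q^{p+1}}).$$ *)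

theory Defs
  imports
    "HOL-Library.Poly_Mapping"
    "HOL-Computational_Algebra.Fraction_Field"
    "HOL-Combinatorics.Permutations"
    "Jordan_Normal_Form.Determinant"
begin

section \<open>The field and its automorphism\<close>

text \<open>
  Polynomials over the rationals in indeterminates indexed by \<^typ>\<open>int\<close> are maps from monomials
  (finitely supported exponent vectors) to coefficients; index \<open>r\<close> stands for the
  indeterminate \<open>t^(q^r)\<close>.
\<close>

type_synonym ratpoly = "(int \<Rightarrow>\<^sub>0 nat) \<Rightarrow>\<^sub>0 rat"
type_synonym ratfun = "ratpoly fract"

definition pvar :: "int \<Rightarrow> ratpoly"
  where "pvar r = Poly_Mapping.single (Poly_Mapping.single r 1) 1"

definition tvar :: "int \<Rightarrow> ratfun"
  where "tvar r = Fract (pvar r) 1"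

text \<open>
  Integer Laurent polynomials \<open>f\<close> in the formal symbol \<open>q\<close> are the finitely supported maps
  \<open>int \<Rightarrow>\<^sub>0 int\<close>; \<open>qpow r\<close> is \<open>q^r\<close>, and \<open>tpow f\<close> is \<open>t^f(q)\<close>.
\<close>

definition qpow :: "nat \<Rightarrow> (int \<Rightarrow>\<^sub>0 int)"
  where "qpow r = Poly_Mapping.single (int r) 1"

definition tpow :: "(int \<Rightarrow>\<^sub>0 int) \<Rightarrow> ratfun"
  where "tpow f = (\<Prod>r\<in>Poly_Mapping.keys f. tvar r powi Poly_Mapping.lookup f r)"

lemma tpow_qpow: "tpow (qpow r) = tvar (int r)"
  by (simp add: tpow_def qpow_def)

text \<open>
  \<^term>\<open>Poly_Mapping.map_key g p\<close> is the composition of \<open>p\<close> with \<open>g\<close>.  Hence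
  \<open>shift_exp\<close> moves the exponent at \<open>r\<close> to \<open>r + 1\<close>, and \<open>shift_poly\<close> moves the coefficient at
  the monomial \<open>e\<close> to \<open>shift_exp e\<close>; see \<open>shift_exp_single\<close> and \<open>shift_poly_single\<close> below.
\<close>

definition shift_exp :: "(int \<Rightarrow>\<^sub>0 nat) \<Rightarrow> (int \<Rightarrow>\<^sub>0 nat)"
  where "shift_exp = Poly_Mapping.map_key (\<lambda>r. r - 1)"

definition unshift_exp :: "(int \<Rightarrow>\<^sub>0 nat) \<Rightarrow> (int \<Rightarrow>\<^sub>0 nat)"
  where "unshift_exp = Poly_Mapping.map_key (\<lambda>r. r + 1)"

definition shift_poly :: "ratpoly \<Rightarrow> ratpoly"
  where "shift_poly = Poly_Mapping.map_key unshift_exp"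

definition unshift_poly :: "ratpoly \<Rightarrow> ratpoly"
  where "unshift_poly = Poly_Mapping.map_key shift_exp"

lemma inj_plus_minus_one [simp]: "inj (\<lambda>r::int. r - 1)" "inj (\<lambda>r::int. r + 1)"
  by (auto simp: inj_def)

lemma unshift_shift_exp [simp]: "unshift_exp (shift_exp e) = e"
  and shift_unshift_exp [simp]: "shift_exp (unshift_exp e) = e"
  by (simp_all add: shift_exp_def unshift_exp_def map_key_compose o_def map_key_id)

lemma inj_shift_exp [simp]: "inj shift_exp" and inj_unshift_exp [simp]: "inj unshift_exp"
  by (metis injI unshift_shift_exp) (metis injI shift_unshift_exp)

lemma unshift_shift_poly [simp]: "unshift_poly (shift_poly p) = p"
  and shift_unshift_poly [simp]: "shift_poly (unshift_poly p) = p"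
  by (simp_all add: shift_poly_def unshift_poly_def map_key_compose o_def map_key_id)

lemma shift_exp_single: "shift_exp (Poly_Mapping.single r c) = Poly_Mapping.single (r + 1) c"
  using map_key_single[of "\<lambda>r::int. r - 1" "r + 1" c] by (simp add: shift_exp_def)

lemma shift_exp_add: "shift_exp (d + e) = shift_exp d + shift_exp e"
  by (simp add: shift_exp_def map_key_plus)

lemma shift_exp_0: "shift_exp 0 = 0"
  by (simp add: shift_exp_def)

lemma shift_poly_single: "shift_poly (Poly_Mapping.single e c) = Poly_Mapping.single (shift_exp e) c"
  using map_key_single[of unshift_exp "shift_exp e" c] by (simp add: shift_poly_def)

lemma shift_poly_0 [simp]: "shift_poly 0 = 0"
  by (simp add: shift_poly_def)

lemma shift_poly_1: "shift_poly 1 = 1"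
  using shift_poly_single[of 0 1] by (simp add: shift_exp_0)

lemma shift_poly_add: "shift_poly (a + b) = shift_poly a + shift_poly b"
  by (simp add: shift_poly_def map_key_plus)

lemma shift_poly_sum: "shift_poly (sum f A) = (\<Sum>x\<in>A. shift_poly (f x))"
  by (induction A rule: infinite_finite_induct) (auto simp: shift_poly_add)

lemma ratpoly_eq_sum_single:
  "(p :: ratpoly) = (\<Sum>e\<in>Poly_Mapping.keys p. Poly_Mapping.single e (Poly_Mapping.lookup p e))"
proof (rule poly_mapping_eqI)
  fix e
  have "Poly_Mapping.lookup (\<Sum>e\<in>Poly_Mapping.keys p. Poly_Mapping.single e (Poly_Mapping.lookup p e)) e
      = (\<Sum>d\<in>Poly_Mapping.keys p. if d = e then Poly_Mapping.lookup p d else 0)"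
    by (simp add: lookup_sum lookup_single when_def)
  also have "\<dots> = Poly_Mapping.lookup p e"
    by (simp add: sum.delta in_keys_iff)
  finally show "Poly_Mapping.lookup p e =
    Poly_Mapping.lookup (\<Sum>e\<in>Poly_Mapping.keys p. Poly_Mapping.single e (Poly_Mapping.lookup p e)) e" ..
qed

lemma shift_poly_mult: "shift_poly (a * b) = shift_poly a * shift_poly b"
proof -
  let ?m = "\<lambda>p e. Poly_Mapping.single e (Poly_Mapping.lookup p e) :: ratpoly"
  have "shift_poly ((\<Sum>d\<in>Poly_Mapping.keys a. ?m a d) * (\<Sum>e\<in>Poly_Mapping.keys b. ?m b e))
      = shift_poly (\<Sum>d\<in>Poly_Mapping.keys a. ?m a d) * shift_poly (\<Sum>e\<in>Poly_Mapping.keys b. ?m b e)"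
    by (simp add: sum_product shift_poly_sum mult_single shift_poly_single shift_exp_add)
  then show ?thesis
    by (simp flip: ratpoly_eq_sum_single)
qed

lemma shift_poly_eq_0_iff [simp]: "shift_poly p = 0 \<longleftrightarrow> p = 0"
  by (metis shift_poly_0 unshift_shift_poly)

text \<open>The choice of numerator and denominator is immaterial, by \<open>phi_Fract\<close>.\<close>

definition phi :: "ratfun \<Rightarrow> ratfun"
  where "phi x =
    (THE y. \<exists>a b. b \<noteq> 0 \<and> x = Fract a b \<and> y = Fract (shift_poly a) (shift_poly b))"

lemma phi_Fract:
  assumes "b \<noteq> 0"
  shows "phi (Fract a b) = Fract (shift_poly a) (shift_poly b)"
  unfolding phi_def
proof (rule the_equality)
  show "\<exists>c d. d \<noteq> 0 \<and> Fract a b = Fract c d \<and>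
      Fract (shift_poly a) (shift_poly b) = Fract (shift_poly c) (shift_poly d)"
    using assms by blast
next
  fix y
  assume "\<exists>c d. d \<noteq> 0 \<and> Fract a b = Fract c d \<and> y = Fract (shift_poly c) (shift_poly d)"
  then obtain c d where cd: "d \<noteq> 0" "Fract a b = Fract c d" "y = Fract (shift_poly c) (shift_poly d)"
    by blast
  from cd assms have "a * d = c * b"
    by (simp add: eq_fract)
  then have "shift_poly a * shift_poly d = shift_poly c * shift_poly b"
    by (metis shift_poly_mult)
  with cd assms show "y = Fract (shift_poly a) (shift_poly b)"
    by (simp add: eq_fract)
qed

lemma phi_tvar: "phi (tvar r) = tvar (r + 1)"
  by (simp add: tvar_def pvar_def phi_Fract shift_poly_single shift_exp_single shift_poly_1)

lemma phi_0: "phi 0 = 0" and phi_1: "phi 1 = 1"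
  by (simp_all add: fract_expand phi_Fract shift_poly_1)

lemma phi_add: "phi (x + y) = phi x + phi y"
  by (cases x; cases y) (simp add: phi_Fract shift_poly_add shift_poly_mult)

lemma phi_mult: "phi (x * y) = phi x * phi y"
  by (cases x; cases y) (simp add: phi_Fract shift_poly_mult)

lemma bij_phi: "bij phi"
proof (rule bijI)
  show "inj phi"
  proof (rule injI)
    fix x y assume "phi x = phi y"
    then show "x = y"
      by (cases x; cases y) (simp add: phi_Fract eq_fract flip: shift_poly_mult,
        metis unshift_shift_poly)
  qed
  have "\<exists>x. y = phi x" for y
  proof (cases y)
    case (Fract a b)
    then have "unshift_poly b \<noteq> 0"
      by (metis shift_poly_0 shift_unshift_poly)
    with Fract have "y = phi (Fract (unshift_poly a) (unshift_poly b))"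
      by (simp add: phi_Fract)
    then show ?thesis ..
  qed
  then show "surj phi"
    by (simp add: surj_def)
qed


section \<open>Factorials and binomials\<close>

definition qt_fact :: "nat \<Rightarrow> ratfun"
  where "qt_fact N = (\<Prod>i<N. 1 - tpow (qpow N - qpow i))"

definition qt_binomial :: "nat \<Rightarrow> nat \<Rightarrow> ratfun"
  where "qt_binomial N j = qt_fact N / (qt_fact j * (phi ^^ j) (qt_fact (N - j)))"


section \<open>The Schur function analogue\<close>

text \<open>
  \<open>lam\<close> lists \<open>N\<close> weakly decreasing parts, zeros included.  Rows, columns and parts are numbered
  from 0, so the exponent \<open>\<lambda>_(j+1) + N - (j+1)\<close> of the 1-based convention appears in column \<open>j\<close>.
\<close>

definition alternant :: "nat \<Rightarrow> nat list \<Rightarrow> ratfun mat"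
  where "alternant N lam = mat N N (\<lambda>(i, j). tpow (qpow (lam ! j + (N - 1 - j))) ^ i)"

definition schur :: "nat \<Rightarrow> nat list \<Rightarrow> ratfun"
  where "schur N lam = det (alternant N lam) / det (alternant N (replicate N 0))"


section \<open>Weights of permutations and ribbon numbers\<close>

text \<open>Partitions with at most \<open>p\<close> parts, all at most \<open>m\<close>, padded with zeros to length \<open>p\<close>.\<close>

definition in_rectangle :: "nat \<Rightarrow> nat \<Rightarrow> nat list \<Rightarrow> bool"
  where "in_rectangle p m lam \<longleftrightarrow>
    length lam = p \<and> sorted_wrt (\<ge>) lam \<and> (\<forall>x\<in>set lam. x \<le> m)"

definition grassmannian :: "nat \<Rightarrow> nat \<Rightarrow> (nat \<Rightarrow> nat) \<Rightarrow> bool"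
  where "grassmannian N p u \<longleftrightarrow>
    u permutes {1..N} \<and> strict_mono_on {1..p} u \<and> strict_mono_on {p+1..N} u"

text \<open>
  The part \<open>\<lambda>_(p+1-i)\<close> is \<open>lam ! (p - i)\<close>, lists being indexed from 0.  The description is
  definite for \<open>lam\<close> inside a \<open>p \<times> (N-p)\<close> rectangle, by \<open>u_perm_ex1\<close>.
\<close>

definition u_perm :: "nat \<Rightarrow> nat \<Rightarrow> nat list \<Rightarrow> nat \<Rightarrow> nat"
  where "u_perm N p lam =
    (THE u. grassmannian N p u \<and> (\<forall>i\<in>{1..p}. u i = lam ! (p - i) + i))"

definition factorization ::
    "nat \<Rightarrow> nat \<Rightarrow> (nat \<Rightarrow> nat) \<Rightarrow> nat list \<times> (nat \<Rightarrow> nat) \<times> (nat \<Rightarrow> nat) \<Rightarrow> bool"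
  where "factorization N p w = (\<lambda>(lam, a, b).
    in_rectangle p (N - p) lam \<and> a permutes {1..p} \<and> b permutes {p+2..N} \<and>
    w = u_perm N p lam \<circ> a \<circ> b)"

lemma strict_mono_on_unique:
  fixes f g :: "nat \<Rightarrow> nat"
  assumes "strict_mono_on {a..b} f" "strict_mono_on {a..b} g" "f ` {a..b} = g ` {a..b}"
    and "i \<in> {a..b}"
  shows "f i = g i"
proof -
  have sorted: "sorted (map h [a..<b+1]) \<and> distinct (map h [a..<b+1])"
    if "strict_mono_on {a..b} h" for h :: "nat \<Rightarrow> nat"
  proof -
    have "sorted_wrt (<) (map h [a..<b+1])"
      unfolding sorted_wrt_map
      by (rule sorted_wrt_mono_rel[OF _ sorted_wrt_upt])
        (use that in \<open>auto simp: strict_mono_on_def\<close>)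
    then show ?thesis by (simp add: strict_sorted_iff)
  qed
  have "set [a..<b+1] = {a..b}" by auto
  then have "map f [a..<b+1] = map g [a..<b+1]"
    using sorted[OF assms(1)] sorted[OF assms(2)] assms(3)
    by (intro sorted_distinct_set_unique) (simp_all only: set_map)
  with \<open>set [a..<b+1] = {a..b}\<close> show ?thesis
    using assms(4) by (metis map_eq_conv)
qed

lemma grassmannian_unique:
  assumes u: "grassmannian N p u" and v: "grassmannian N p v" and "p \<le> N"
    and eq: "u ` {1..p} = v ` {1..p}"
  shows "u = v"
proof
  have compl: "h ` {p+1..N} = {1..N} - h ` {1..p}" if "grassmannian N p h" for h
  proof -
    have "h permutes {1..N}" using that by (simp add: grassmannian_def)
    then have "h ` {1..N} = {1..N}" "inj h"
      by (auto simp: permutes_image permutes_inj)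
    moreover have "{p+1..N} = {1..N} - {1..p}" using \<open>p \<le> N\<close> by auto
    ultimately show ?thesis by (simp add: image_set_diff)
  qed
  fix i
  consider "i \<in> {1..p}" | "i \<in> {p+1..N}" | "i \<notin> {1..N}" by fastforce
  then show "u i = v i"
  proof cases
    case 1
    then show ?thesis using strict_mono_on_unique[OF _ _ eq] u v by (simp add: grassmannian_def)
  next
    case 2
    have "u ` {p+1..N} = v ` {p+1..N}" using compl u v eq by simp
    then show ?thesis using strict_mono_on_unique[of "p+1" N u v] u v 2
      by (simp add: grassmannian_def)
  next
    case 3
    then show ?thesis using u v by (simp add: grassmannian_def permutes_def)
  qed
qed

lemma ex_strict_mono_on_enum:
  fixes S :: "nat set"
  assumes "finite S" "card S = m"
  shows "\<exists>f. strict_mono_on {a+1..a+m} f \<and> f ` {a+1..a+m} = S"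
proof (intro exI conjI)
  let ?xs = "sorted_list_of_set S" and ?f = "\<lambda>i. sorted_list_of_set S ! (i - (a+1))"
  have len: "length ?xs = m" using assms by simp
  show "strict_mono_on {a+1..a+m} ?f"
    by (intro strict_mono_onI sorted_wrt_nth_less[OF strict_sorted_list_of_set]) (use len in auto)
  show "?f ` {a+1..a+m} = S"
  proof (rule subset_antisym; rule subsetI)
    fix x assume "x \<in> ?f ` {a+1..a+m}"
    then obtain i where "i \<in> {a+1..a+m}" "x = ?f i" by blast
    moreover from this have "i - (a+1) < length ?xs" using len by auto
    ultimately show "x \<in> S" using assms(1) nth_mem[of "i - (a+1)" ?xs] by simp
  next
    fix x assume "x \<in> S"
    then obtain j where "j < m" "x = ?xs ! j"
      using len assms(1) by (metis in_set_conv_nth set_sorted_list_of_set)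
    then show "x \<in> ?f ` {a+1..a+m}" by (intro image_eqI[of _ _ "j + (a+1)"]) auto
  qed
qed

lemma ex_grassmannian:
  assumes "S \<subseteq> {1..N}" "card S = p"
  shows "\<exists>u. grassmannian N p u \<and> u ` {1..p} = S"
proof -
  have fin: "finite S" using assms(1) finite_subset by blast
  have "p \<le> N" using assms card_mono[OF _ assms(1)] by simp
  obtain f where f: "strict_mono_on {1..p} f" "f ` {1..p} = S"
    using ex_strict_mono_on_enum[OF fin assms(2), of 0] by auto
  have "card ({1..N} - S) = N - p" using assms fin by (simp add: card_Diff_subset)
  then obtain g where g: "strict_mono_on {p+1..N} g" "g ` {p+1..N} = {1..N} - S"
    using ex_strict_mono_on_enum[of "{1..N} - S" "N - p" p] \<open>p \<le> N\<close> by auto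
  let ?u = "\<lambda>i. if i \<in> {1..p} then f i else if i \<in> {p+1..N} then g i else i"
  have "?u ` {1..p} = f ` {1..p}" by (rule image_cong) auto
  then have u1: "?u ` {1..p} = S" using f(2) by (simp only:)
  have "?u ` {p+1..N} = g ` {p+1..N}" by (rule image_cong) auto
  then have u2: "?u ` {p+1..N} = {1..N} - S" using g(2) by (simp only:)
  have "{1..N} = {1..p} \<union> {p+1..N}" using \<open>p \<le> N\<close> by auto
  then have "?u ` {1..N} = ?u ` {1..p} \<union> ?u ` {p+1..N}" by (simp only: image_Un)
  then have im: "?u ` {1..N} = {1..N}" using assms(1) unfolding u1 u2 by blast
  have "inj_on ?u {1..N}" by (rule eq_card_imp_inj_on) (simp_all only: im finite_atLeastAtMost)
  then have "bij_betw ?u {1..N} {1..N}" using im by (rule bij_betw_imageI)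
  moreover have "?u i = i" if "i \<notin> {1..N}" for i
  proof -
    have "i \<notin> {1..p}" "i \<notin> {p+1..N}" using that \<open>p \<le> N\<close> by auto
    then show ?thesis by (simp only: if_False)
  qed
  ultimately have "?u permutes {1..N}" by (rule bij_imp_permutes)
  moreover have "strict_mono_on {1..p} ?u" "strict_mono_on {p+1..N} ?u"
    using f(1) g(1) by (auto simp: strict_mono_on_def)
  ultimately show ?thesis using u1 unfolding grassmannian_def by blast
qed

lemma u_perm_ex1:
  assumes "in_rectangle p (N - p) lam" "p \<le> N"
  shows "\<exists>!u. grassmannian N p u \<and> (\<forall>i\<in>{1..p}. u i = lam ! (p - i) + i)"
proof -
  let ?f = "\<lambda>i. lam ! (p - i) + i"
  have len: "length lam = p" and sorted: "sorted_wrt (\<ge>) lam" and le: "\<forall>x\<in>set lam. x \<le> N - p"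
    using assms by (auto simp: in_rectangle_def)
  have mono: "strict_mono_on {1..p} ?f"
  proof (rule strict_mono_onI)
    fix i j assume ij: "i \<in> {1..p}" "j \<in> {1..p}" "i < j"
    then have "lam ! (p - j) \<ge> lam ! (p - i)"
      by (intro sorted_wrt_nth_less[OF sorted]) (use len in auto)
    with ij show "?f i < ?f j" by simp
  qed
  have sub: "?f ` {1..p} \<subseteq> {1..N}"
  proof (rule image_subsetI)
    fix i assume i: "i \<in> {1..p}"
    then have "lam ! (p - i) \<le> N - p" using le len by auto
    with i assms(2) show "?f i \<in> {1..N}" by auto
  qed
  have card: "card (?f ` {1..p}) = p"
    using strict_mono_on_imp_inj_on[OF mono] by (simp add: card_image)
  obtain u where u: "grassmannian N p u" "u ` {1..p} = ?f ` {1..p}"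
    using ex_grassmannian[OF sub card] by (elim exE conjE)
  have u_eq: "\<forall>i\<in>{1..p}. u i = ?f i"
  proof
    fix i assume "i \<in> {1..p}"
    moreover have "strict_mono_on {1..p} u" using u(1) by (simp add: grassmannian_def)
    ultimately show "u i = ?f i" using strict_mono_on_unique[OF _ mono u(2)] by simp
  qed
  show ?thesis
  proof (intro ex1I[of _ u] conjI u(1) u_eq)
    fix v assume v: "grassmannian N p v \<and> (\<forall>i\<in>{1..p}. v i = ?f i)"
    then have "v ` {1..p} = ?f ` {1..p}" by (intro image_cong) auto
    then have "v ` {1..p} = u ` {1..p}" using u(2) by (simp only:)
    then show "v = u" using grassmannian_unique[OF _ u(1) assms(2)] v by (elim conjE)
  qed
qed

lemmas u_perm_grassmannian = theI'[OF u_perm_ex1, folded u_perm_def, THEN conjunct1]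
lemmas u_perm_apply = theI'[OF u_perm_ex1, folded u_perm_def, THEN conjunct2, rule_format]

lemma strict_mono_on_gap:
  fixes u :: "nat \<Rightarrow> nat"
  assumes "strict_mono_on {a..b} u" "a \<le> i" "i \<le> j" "j \<le> b"
  shows "u i + (j - i) \<le> u j"
  using assms(3,4)
proof (induction j rule: dec_induct)
  case (step j)
  then have "u j < u (Suc j)"
    using assms by (auto simp: strict_mono_on_def)
  with step show ?case by simp
qed simp

lemma factorization_image:
  assumes "factorization N p w (lam, a, b)" "p < N"
  shows "w ` {1..p} = u_perm N p lam ` {1..p}"
    and "\<And>i. i \<in> {1..p} \<Longrightarrow> w i = u_perm N p lam (a i)"
    and "\<And>i. i \<in> {p+2..N} \<Longrightarrow> w i = u_perm N p lam (b i)"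
    and "w (p + 1) = u_perm N p lam (p + 1)"
proof -
  have a: "a permutes {1..p}" and b: "b permutes {p+2..N}" and w: "w = u_perm N p lam \<circ> a \<circ> b"
    using assms by (auto simp: factorization_def)
  show w1: "w i = u_perm N p lam (a i)" if "i \<in> {1..p}" for i
    using that w permutes_not_in[OF b, of i] by simp
  then have "w ` {1..p} = u_perm N p lam ` (a ` {1..p})"
    by (auto simp: image_image intro!: image_cong)
  then show "w ` {1..p} = u_perm N p lam ` {1..p}"
    using a by (simp add: permutes_image)
  show "w i = u_perm N p lam (b i)" if "i \<in> {p+2..N}" for i
  proof -
    have "b i \<in> {p+2..N}" using that permutes_in_image[OF b] by blast
    then show ?thesis using w permutes_not_in[OF a, of "b i"] by simp
  qed
  show "w (p + 1) = u_perm N p lam (p + 1)"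
    using w permutes_not_in[OF a, of "p+1"] permutes_not_in[OF b, of "p+1"] by simp
qed

lemma factorization_unique:
  assumes "factorization N p w (lam, a, b)" "factorization N p w (lam', a', b')" "p < N"
  shows "lam = lam' \<and> a = a' \<and> b = b'"
proof -
  let ?u = "u_perm N p lam" and ?v = "u_perm N p lam'"
  have rect: "in_rectangle p (N - p) lam" "in_rectangle p (N - p) lam'"
    and perm: "a permutes {1..p}" "b permutes {p+2..N}" "a' permutes {1..p}" "b' permutes {p+2..N}"
    using assms by (auto simp: factorization_def)
  note le = less_imp_le[OF assms(3)]
  note u = u_perm_grassmannian[OF rect(1) le] u_perm_apply[OF rect(1) le]
  note v = u_perm_grassmannian[OF rect(2) le] u_perm_apply[OF rect(2) le]
  have "?u ` {1..p} = ?v ` {1..p}"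
    using factorization_image(1)[OF assms(1,3)] factorization_image(1)[OF assms(2,3)] by (rule subst)
  then have uv: "?u = ?v"
    by (rule grassmannian_unique[OF u(1) v(1) le])
  have inj: "inj ?u"
    using u(1) unfolding grassmannian_def by (blast intro: permutes_inj)
  have "lam ! j = lam' ! j" if "j < p" for j
  proof -
    have "p - j \<in> {1..p}" "p - (p - j) = j" using that by auto
    then have "lam ! j + (p - j) = lam' ! j + (p - j)"
      using u(2)[of "p - j"] v(2)[of "p - j"] uv by simp
    then show ?thesis by simp
  qed
  then have "lam = lam'"
    using rect by (auto simp: in_rectangle_def intro: nth_equalityI)
  moreover have "a i = a' i" for i
  proof (cases "i \<in> {1..p}")
    case True
    then show ?thesis
      using factorization_image(2)[OF assms(1,3)] factorization_image(2)[OF assms(2,3)] uv inj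
      by (metis injD)
  next
    case False
    then show ?thesis using perm by (simp add: permutes_def)
  qed
  moreover have "b i = b' i" for i
  proof (cases "i \<in> {p+2..N}")
    case True
    then show ?thesis
      using factorization_image(3)[OF assms(1,3)] factorization_image(3)[OF assms(2,3)] uv inj
      by (metis injD)
  next
    case False
    then show ?thesis using perm by (simp add: permutes_def)
  qed
  ultimately show ?thesis by blast
qed

lemma factorization_parts_nonzero:
  assumes "factorization N p w (lam, a, b)" "p < N" "w permutes {1..N}" "w (p + 1) = 1"
  shows "0 \<notin> set lam"
proof
  let ?u = "u_perm N p lam"
  have rect: "in_rectangle p (N - p) lam"
    using assms by (auto simp: factorization_def)
  note u = u_perm_grassmannian[OF rect less_imp_le[OF assms(2)]]
    u_perm_apply[OF rect less_imp_le[OF assms(2)]]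
  have inj: "inj ?u" and mono: "strict_mono_on {1..p} ?u"
    using u(1) unfolding grassmannian_def by (blast intro: permutes_inj)+
  assume "0 \<in> set lam"
  then obtain j where j: "j < p" "lam ! j = 0"
    using rect by (auto simp: in_set_conv_nth in_rectangle_def)
  then have "p - j \<in> {1..p}" "p - (p - j) = j" by auto
  then have "?u (p - j) = p - j" using u(2)[of "p - j"] j by simp
  moreover have "?u 1 + (p - j - 1) \<le> ?u (p - j)"
    using strict_mono_on_gap[OF mono, of 1 "p - j"] j by auto
  moreover have "?u 1 \<in> {1..N}"
    using u(1) assms(2) permutes_in_image[of ?u "{1..N}" 1] by (simp add: grassmannian_def)
  ultimately have "?u 1 = 1"
    using j by auto
  moreover have "?u (p + 1) = 1"
    using factorization_image(4)[OF assms(1,2)] assms(4) by simp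
  ultimately have "p + 1 = 1"
    using inj by (metis injD)
  with j show False by simp
qed

lemma ex_factorization:
  assumes "p < N" "w permutes {1..N}" "w (p + 1) = 1"
  shows "\<exists>lam a b. factorization N p w (lam, a, b)"
proof -
  have inj_w: "inj w" using assms(2) by (rule permutes_inj)
  have "w ` {1..p} \<subseteq> w ` {1..N}" using assms(1) by (intro image_mono) auto
  then have sub: "w ` {1..p} \<subseteq> {1..N}" using assms(2) by (simp only: permutes_image)
  have card: "card (w ` {1..p}) = p"
    using card_image[OF inj_on_subset[OF inj_w subset_UNIV], of "{1..p}"] by simp
  obtain u where u: "grassmannian N p u" "u ` {1..p} = w ` {1..p}"
    using ex_grassmannian[OF sub card] by (elim exE conjE)
  then have perm_u: "u permutes {1..N}" and mono: "strict_mono_on {1..p} u"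
    and mono': "strict_mono_on {p+1..N} u" by (auto simp: grassmannian_def)
  have inj_u: "inj u" using perm_u by (rule permutes_inj)
  have u_range: "u i \<in> {1..N}" if "i \<in> {1..N}" for i
    using that permutes_in_image[OF perm_u] by blast
  define lam where "lam = map (\<lambda>j. u (p - j) - (p - j)) [0..<p]"
  have ge: "i \<le> u i" if "i \<in> {1..p}" for i
    using strict_mono_on_gap[OF mono, of 1 i] u_range[of 1] that assms(1) by auto
  have lam_nth: "lam ! (p - i) + i = u i" if "i \<in> {1..p}" for i
    using that ge[OF that] by (simp add: lam_def)
  have rect: "in_rectangle p (N - p) lam"
    unfolding in_rectangle_def
  proof (intro conjI ballI)
    show "length lam = p" by (simp add: lam_def)
    show "sorted_wrt (\<ge>) lam"
      unfolding sorted_wrt_iff_nth_less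
    proof (intro allI impI)
      fix i j assume ij: "i < j" "j < length lam"
      then have p: "j < p" by (simp add: lam_def)
      have "u (p - j) + (j - i) \<le> u (p - i)"
        using strict_mono_on_gap[OF mono, of "p - j" "p - i"] ij p by simp
      moreover have "p - i = (p - j) + (j - i)" using ij p by simp
      moreover have "lam ! i = u (p - i) - (p - i)" "lam ! j = u (p - j) - (p - j)"
        using ij p by (simp_all add: lam_def)
      ultimately show "lam ! i \<ge> lam ! j" by linarith
    qed
    fix x assume "x \<in> set lam"
    then obtain j where j: "j < p" "x = u (p - j) - (p - j)"
      by (auto simp: lam_def)
    have "u (p - j) + j \<le> u p"
      using strict_mono_on_gap[OF mono, of "p - j" p] j by simp
    moreover have "u p \<le> N" using u_range[of p] j assms(1) by auto
    ultimately show "x \<le> N - p" using j assms(1) by linarith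
  qed
  have u_eq: "u_perm N p lam = u"
    unfolding u_perm_def
    using u(1) lam_nth by (intro the1_equality[OF u_perm_ex1[OF rect]] less_imp_le assms(1)) auto
  define c where "c = inv_into UNIV u \<circ> w"
  have perm_c: "c permutes {1..N}"
    unfolding c_def by (intro permutes_compose assms(2) permutes_inv perm_u)
  have uc: "u (c i) = w i" for i
    by (simp add: c_def surj_f_inv_f[OF permutes_surj[OF perm_u]])
  have inj_c: "inj c" using perm_c by (rule permutes_inj)
  have "u ` (c ` {1..p}) = u ` {1..p}" using uc u(2) by (simp add: image_image)
  then have c1: "c ` {1..p} = {1..p}" using inj_u by (simp add: inj_image_eq_iff)
  have "u (p + 1) = 1"
  proof -
    have "1 \<in> {1..N}" using assms(1) by auto
    then obtain j where j: "j \<in> {1..N}" "u j = 1"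
      using permutes_image[OF perm_u] by (metis imageE)
    have "j \<notin> {1..p}"
    proof
      assume "j \<in> {1..p}"
      then have "1 \<in> w ` {1..p}" using u(2) j by (metis imageI)
      then obtain i where i: "i \<in> {1..p}" "w i = w (p + 1)" using assms(3) by auto
      then have "i = p + 1" using inj_w by (metis injD)
      with i show False by simp
    qed
    then have "u (p + 1) + (j - (p + 1)) \<le> u j"
      using strict_mono_on_gap[OF mono', of "p + 1" j] j by auto
    moreover have "1 \<le> u (p + 1)" using u_range[of "p + 1"] assms(1) by simp
    ultimately show ?thesis using j(2) by linarith
  qed
  then have c2: "c (p + 1) = p + 1" using uc assms(3) inj_u by (metis injD)
  have "{p+2..N} = {1..N} - {1..p} - {p + 1}" using assms(1) by auto
  then have "c ` {p+2..N} = c ` {1..N} - c ` {1..p} - c ` {p + 1}"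
    by (simp only: image_set_diff[OF inj_c])
  also have "\<dots> = {p+2..N}" using c1 c2 assms(1) permutes_image[OF perm_c] by auto
  finally have c3: "c ` {p+2..N} = {p+2..N}" .
  let ?a = "\<lambda>i. if i \<in> {1..p} then c i else i"
  let ?b = "\<lambda>i. if i \<in> {p+2..N} then c i else i"
  have "?a permutes {1..p}"
  proof (rule bij_imp_permutes)
    have "bij_betw c {1..p} {1..p}"
      using inj_on_subset[OF inj_c subset_UNIV] c1 by (rule bij_betw_imageI)
    also have "bij_betw c {1..p} {1..p} = bij_betw ?a {1..p} {1..p}"
      by (rule bij_betw_cong) simp
    finally show "bij_betw ?a {1..p} {1..p}" .
  qed (simp only: if_False)
  moreover have "?b permutes {p+2..N}"
  proof (rule bij_imp_permutes)
    have "bij_betw c {p+2..N} {p+2..N}"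
      using inj_on_subset[OF inj_c subset_UNIV] c3 by (rule bij_betw_imageI)
    also have "bij_betw c {p+2..N} {p+2..N} = bij_betw ?b {p+2..N} {p+2..N}"
      by (rule bij_betw_cong) simp
    finally show "bij_betw ?b {p+2..N} {p+2..N}" .
  qed (simp only: if_False)
  moreover have "w = u \<circ> ?a \<circ> ?b"
  proof
    fix i
    have "?a (?b i) = c i"
    proof (cases "i \<in> {p+2..N}")
      case True
      then have "c i \<in> {p+2..N}" using c3 by blast
      with True show ?thesis by auto
    next
      case False
      then consider "i \<in> {1..p}" | "i = p + 1" | "i \<notin> {1..N}"
        unfolding atLeastAtMost_iff by linarith
      then show ?thesis
        using False c2 permutes_not_in[OF perm_c, of i] assms(1) by cases auto
    qed
    then have "u (?a (?b i)) = u (c i)" by (rule arg_cong)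
    with uc[of i] show "w i = (u \<circ> ?a \<circ> ?b) i" by (simp only: o_apply)
  qed
  ultimately have "factorization N p w (lam, ?a, ?b)"
    using rect unfolding factorization_def prod.case u_eq by (intro conjI)
  then show ?thesis by (intro exI)
qed

theorem factorization_ex1:
  assumes "w permutes {1..N}" "N \<ge> 1" "p = inv_into UNIV w 1 - 1"
  shows "\<exists>!f. factorization N p w f"
    and "\<And>lam a b. factorization N p w (lam, a, b) \<Longrightarrow> 0 \<notin> set lam"
proof -
  have "inv_into UNIV w 1 \<in> {1..N}"
    using permutes_in_image[OF permutes_inv[OF assms(1)], of 1] assms(2) by simp
  then have p: "p < N" "p + 1 = inv_into UNIV w 1" using assms(3) by auto
  then have w: "w (p + 1) = 1"
    by (simp add: surj_f_inv_f[OF permutes_surj[OF assms(1)]])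
  show "\<exists>!f. factorization N p w f"
  proof (rule ex_ex1I)
    show "\<exists>f. factorization N p w f" using ex_factorization[OF p(1) assms(1) w] by blast
  next
    fix f g assume "factorization N p w f" "factorization N p w g"
    then show "f = g"
      using factorization_unique[OF _ _ p(1)] by (cases f; cases g) blast
  qed
  show "0 \<notin> set lam" if "factorization N p w (lam, a, b)" for lam a b
    using factorization_parts_nonzero[OF that p(1) assms(1) w] .
qed

text \<open>
  A permutation \<open>b\<close> of \<open>{p+2..N}\<close> becomes the permutation \<open>i \<mapsto> b (i + (p+1)) - (p+1)\<close> of
  \<open>{1..N-p-1}\<close>.  The factorization exists and is unique, and subtracting 1 from each part does
  not truncate, by \<open>factorization_ex1\<close>.  The value 0 for arguments that are not permutations only serves totality.
\<close>

function wt :: "nat \<Rightarrow> (nat \<Rightarrow> nat) \<Rightarrow> ratfun" where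
  "wt N w =
    (if N \<le> 1 then 1
     else if \<not> w permutes {1..N} then 0
     else
       let p = inv_into UNIV w 1 - 1;
           (lam, a, b) = (THE f. factorization N p w f)
       in tpow (qpow p - qpow 0) * (phi (qt_fact p) / qt_fact p)
          * phi (wt (N - 1) (u_perm (N - 1) p (map (\<lambda>x. x - 1) lam)))
          * wt p a
          * (phi ^^ (p + 1)) (wt (N - p - 1) (\<lambda>i. b (i + (p + 1)) - (p + 1))))"
  by pat_completeness auto
termination
proof (relation "measure fst", goal_cases)
  case (3 N w p)
  then have "inv_into UNIV w 1 \<in> {1..N}"
    using permutes_in_image[OF permutes_inv[of w "{1..N}"], of 1] by auto
  with 3 show ?case by auto
qed auto

declare wt.simps [simp del]

text \<open>Lengths of the maximal increasing consecutive runs of a list.\<close>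

fun run_lengths :: "nat list \<Rightarrow> nat list" where
  "run_lengths [] = []"
| "run_lengths [x] = [1]"
| "run_lengths (x # y # zs) =
    (if x < y then Suc (hd (run_lengths (y # zs))) # tl (run_lengths (y # zs))
     else 1 # run_lengths (y # zs))"

definition descent_composition :: "nat \<Rightarrow> (nat \<Rightarrow> nat) \<Rightarrow> nat list"
  where "descent_composition N w = run_lengths (map w [1..<N+1])"

definition ribbon :: "nat list \<Rightarrow> ratfun"
  where "ribbon \<alpha> =
    (\<Sum>w | w permutes {1..sum_list \<alpha>} \<and> descent_composition (sum_list \<alpha>) w = \<alpha>.
      wt (sum_list \<alpha>) w)"

end

theory Submission
  imports Defs
begin

text \<open>
  Write \<open>T i\<close> for \<open>t^(q^i)\<close>.  Both sides turn out to be the same product of quotients of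
  differences of the \<open>T i\<close>.

  The two determinants defining the Schur function are Vandermonde determinants
  (\<open>det_vandermonde\<close>).  Their node lists differ in one node only, because the exponents
  \<open>\<lambda>_j + N - j\<close> of a hook \<open>(m, 1^k)\<close> are \<open>{0..n}\<close> with \<open>n - k\<close> replaced by \<open>m + n\<close>.  All factors
  not involving that node cancel, and \<open>schur_hook\<close> remains: a product over the nodes
  \<open>T i\<close> with \<open>i < n - k\<close>, which is exactly the binomial coefficient (\<open>qt_binomial_eq\<close>), times a
  product over the nodes with \<open>n - k < i \<le> n\<close>.

  The second product is the shifted ribbon number.  A permutation with descent composition
  \<open>(1^k, m)\<close> falls to the value 1 at position \<open>k + 1\<close> and rises from there on.  So in its factorization
  \<open>u_\<lambda> a e b\<close> the factor \<open>a\<close> is the reversal of \<open>{1..k}\<close>, \<open>b\<close> is the identity, and \<open>\<lambda>\<close> is any partition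
  with \<open>k\<close> nonzero parts, all at most \<open>m\<close>.  The defining recursion of the weight therefore expresses the ribbon
  number through the weight of a reversal and the sum of \<open>wt u_\<mu>\<close> over all \<open>\<mu>\<close> inside a
  \<open>k \<times> (m - 1)\<close> rectangle.  This sum is a binomial coefficient (\<open>sum_wt_u_perm\<close>): splitting the partitions by
  whether the last part vanishes gives it the \<open>(q,t)\<close>-Pascal recurrence \<open>qt_binomial_Suc_Suc\<close>.
  The weight of the reversal is a product of block factors that telescopes (\<open>prod_block_weight\<close>).
\<close>

section \<open>Field algebra of the indeterminates\<close>

text \<open>
  Only nonnegative exponents \<open>i\<close> of \<open>q\<close> occur.  This is a constant of its own, so that index arithmetic
  stays in \<^typ>\<open>nat\<close> during simplification.
\<close>

definition T :: "nat \<Rightarrow> ratfun"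
  where "T i = tvar (int i)"

lemma T_eq_iff [simp]: "T i = T j \<longleftrightarrow> i = j"
proof
  assume "T i = T j"
  then have "Poly_Mapping.single (Poly_Mapping.single (int i) (1::nat)) (1::rat)
      = Poly_Mapping.single (Poly_Mapping.single (int j) 1) 1"
    by (simp add: T_def tvar_def pvar_def eq_fract)
  then have "Poly_Mapping.keys (Poly_Mapping.single (Poly_Mapping.single (int i) (1::nat)) (1::rat))
      = Poly_Mapping.keys (Poly_Mapping.single (Poly_Mapping.single (int j) (1::nat)) (1::rat))"
    by (rule arg_cong)
  then have "Poly_Mapping.single (int i) (1::nat) = Poly_Mapping.single (int j) 1"
    by (simp only: keys_single one_neq_zero if_False singleton_insert_inj_eq simp_thms)
  then have "Poly_Mapping.keys (Poly_Mapping.single (int i) (1::nat))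
      = Poly_Mapping.keys (Poly_Mapping.single (int j) (1::nat))"
    by (rule arg_cong)
  then show "i = j" by simp
qed simp

lemma T_nonzero [simp]: "T i \<noteq> 0"
proof -
  have "pvar (int i) \<noteq> 0"
    unfolding pvar_def by (metis lookup_single_eq lookup_zero zero_neq_one)
  then show ?thesis by (simp add: T_def tvar_def eq_fract fract_expand)
qed

lemma tpow_diff: "tpow (qpow a - qpow b) = T a / T b"
proof (cases "a = b")
  case False
  have keys: "Poly_Mapping.keys (qpow a - qpow b) = {int a, int b}"
    using False by (auto simp: qpow_def in_keys_iff lookup_minus lookup_single when_def split: if_splits)
  show ?thesis
    unfolding tpow_def keys using False
    by (simp add: T_def qpow_def lookup_minus lookup_single when_def power_int_minus field_simps)
qed (simp add: tpow_def)

lemma phi_uminus: "phi (- x) = - phi x"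
  by (metis add.right_inverse add_eq_0_iff phi_0 phi_add)

lemma phi_diff: "phi (x - y) = phi x - phi y"
  by (metis diff_conv_add_uminus phi_add phi_uminus)

lemma phi_divide: "phi (x / y) = phi x / phi y"
proof (cases "y = 0")
  case False
  then have "phi y \<noteq> 0"
    by (metis bij_betw_imp_inj_on bij_phi injD phi_0)
  moreover have "phi (x / y) * phi y = phi x"
    using False by (simp flip: phi_mult)
  ultimately show ?thesis by (simp add: field_simps)
qed (simp add: phi_0)

lemma phi_prod: "phi (\<Prod>i\<in>A. f i) = (\<Prod>i\<in>A. phi (f i))"
  by (induction A rule: infinite_finite_induct) (auto simp: phi_1 phi_mult)

lemma phi_sum: "phi (\<Sum>i\<in>A. f i) = (\<Sum>i\<in>A. phi (f i))"
  by (induction A rule: infinite_finite_induct) (auto simp: phi_0 phi_add)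

lemma phi_T: "phi (T i) = T (Suc i)"
  by (simp add: T_def phi_tvar add.commute)

lemmas phi_simps = phi_0 phi_1 phi_T phi_mult phi_diff phi_divide phi_prod

lemma phi_funpow_prod_ratio:
  "(phi ^^ d) (\<Prod>i\<in>A. (T (a i) - T (b i)) / (T (c i) - T (e i)))
    = (\<Prod>i\<in>A. (T (a i + d) - T (b i + d)) / (T (c i + d) - T (e i + d)))"
  by (induction d) (simp_all add: phi_simps)

lemma qt_fact_eq: "qt_fact N = (\<Prod>i<N. (T i - T N) / T i)"
  by (simp add: qt_fact_def tpow_diff diff_divide_distrib)

lemma phi_funpow_qt_fact: "(phi ^^ d) (qt_fact N) = (\<Prod>i<N. (T (i + d) - T (N + d)) / T (i + d))"
  by (induction d) (simp_all add: phi_simps qt_fact_eq)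

text \<open>
  The factors of \<open>N!\<close> with index at least \<open>j\<close> form the \<open>j\<close>-fold shift of \<open>(N - j)!\<close>, so that only \<open>j\<close> factors
  of \<open>N!\<close> survive in the binomial coefficient; the monomials \<open>T i\<close> below them cancel against those
  of \<open>j!\<close>.
\<close>

lemma qt_binomial_eq:
  assumes "j \<le> N"
  shows "qt_binomial N j = (\<Prod>i<j. (T i - T N) / (T i - T j))"
proof -
  have split: "qt_fact N = (\<Prod>i<j. (T i - T N) / T i) * (phi ^^ j) (qt_fact (N - j))"
  proof -
    have "qt_fact N = (\<Prod>i<j. (T i - T N) / T i) * (\<Prod>i\<in>{j..<N}. (T i - T N) / T i)"
      unfolding qt_fact_eq using assms
      by (subst prod.union_disjoint[symmetric]) (auto simp: ivl_disj_un)
    also have "(\<Prod>i\<in>{j..<N}. (T i - T N) / T i)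
        = (\<Prod>i<N - j. (T (i + j) - T N) / T (i + j))"
      using prod.shift_bounds_nat_ivl[of "\<lambda>i. (T i - T N) / T i" 0 j "N - j"] assms
      by (simp add: atLeast0LessThan)
    finally show ?thesis using assms by (simp add: phi_funpow_qt_fact)
  qed
  have "(phi ^^ j) (qt_fact (N - j)) \<noteq> 0"
    using assms by (auto simp: phi_funpow_qt_fact)
  then have "qt_binomial N j = (\<Prod>i<j. (T i - T N) / T i) / qt_fact j"
    by (simp add: qt_binomial_def split)
  also have "\<dots> = (\<Prod>i<j. (T i - T N) / (T i - T j))"
    by (simp add: qt_fact_eq flip: prod_dividef)
  finally show ?thesis .
qed

text \<open>
  The factor by which the recursion of \<^const>\<open>wt\<close> multiplies the weights of its three smaller permutations.
\<close>

definition block_weight :: "nat \<Rightarrow> ratfun"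
  where "block_weight p = tpow (qpow p - qpow 0) * (phi (qt_fact p) / qt_fact p)"

text \<open>
  The monomial prefactor \<open>T p / T 0\<close> telescopes over the \<open>p\<close> factors; distributed in this way it absorbs the
  monomials of the two factorials.
\<close>

lemma block_weight_eq: "block_weight p = (\<Prod>i<p. (T (Suc i) - T (Suc p)) / (T i - T p))"
proof -
  have tele: "T p / T 0 = (\<Prod>i<p. T (Suc i) / T i)" for p
    by (induction p) (simp_all add: field_simps)
  have "phi (qt_fact p) / qt_fact p
      = (\<Prod>i<p. (T (Suc i) - T (Suc p)) / T (Suc i) / ((T i - T p) / T i))"
    by (simp add: qt_fact_eq phi_prod phi_divide phi_diff phi_T flip: prod_dividef)
  then have "block_weight p
      = (\<Prod>i<p. T (Suc i) / T i * ((T (Suc i) - T (Suc p)) / T (Suc i) / ((T i - T p) / T i)))"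
    unfolding block_weight_def tpow_diff tele prod.distrib by simp
  then show ?thesis by (simp add: mult.commute)
qed

text \<open>
  The \<open>(q,t)\<close>-Pascal recurrence.  By the closed forms all three terms are multiples of \<open>phi (qt_binomial N k)\<close>, and the
  recurrence reduces to \<open>T 0 - T (N + 1) = (T 0 - T (k + 1)) + (T (k + 1) - T (N + 1))\<close>.
\<close>

lemma qt_binomial_Suc_Suc:
  assumes "k < N"
  shows "qt_binomial (Suc N) (Suc k)
    = phi (qt_binomial N k) + block_weight (Suc k) * phi (qt_binomial N (Suc k))"
proof -
  define F where "F = (\<Prod>i<k. (T (Suc i) - T (Suc N)) / (T (Suc i) - T (Suc k)))"
  have F: "phi (qt_binomial N k) = F"
    using assms by (simp add: F_def qt_binomial_eq phi_simps flip: prod_dividef)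
  have "qt_binomial (Suc N) (Suc k) = (\<Prod>i<Suc k. (T i - T (Suc N)) / (T i - T (Suc k)))"
    using assms by (intro qt_binomial_eq) simp
  also have "\<dots> = (T 0 - T (Suc N)) / (T 0 - T (Suc k)) * F"
    unfolding F_def by (rule prod.lessThan_Suc_shift)
  also have "(T 0 - T (Suc N)) / (T 0 - T (Suc k))
      = 1 + (T (Suc k) - T (Suc N)) / (T 0 - T (Suc k))"
    by (simp add: field_simps)
  finally have lhs: "qt_binomial (Suc N) (Suc k)
      = (1 + (T (Suc k) - T (Suc N)) / (T 0 - T (Suc k))) * F" .
  have "block_weight (Suc k) * phi (qt_binomial N (Suc k))
      = (\<Prod>i<Suc k. (T (Suc i) - T (Suc (Suc k))) / (T i - T (Suc k))
          * ((T (Suc i) - T (Suc N)) / (T (Suc i) - T (Suc (Suc k)))))"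
    using assms unfolding block_weight_eq prod.distrib
    by (simp add: qt_binomial_eq phi_simps del: prod.lessThan_Suc flip: prod_dividef)
  also have "\<dots> = (\<Prod>i<Suc k. (T (Suc i) - T (Suc N)) / (T i - T (Suc k)))"
    by (intro prod.cong) auto
  also have "\<dots> = (\<Prod>i<Suc k. T (Suc i) - T (Suc N)) / (\<Prod>i<Suc k. T i - T (Suc k))"
    by (rule prod_dividef)
  also have "(\<Prod>i<Suc k. T i - T (Suc k))
      = (T 0 - T (Suc k)) * (\<Prod>i<k. T (Suc i) - T (Suc k))"
    by (rule prod.lessThan_Suc_shift)
  finally have "block_weight (Suc k) * phi (qt_binomial N (Suc k))
      = (T (Suc k) - T (Suc N)) / (T 0 - T (Suc k)) * F"
    by (simp add: F_def prod_dividef mult.commute)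
  with lhs F show ?thesis by (simp add: distrib_right)
qed

text \<open>
  The denominators of each block factor are, up to their first entry, the numerators of
  the preceding block factor, so the product telescopes.
\<close>

lemma prod_block_weight:
  "(\<Prod>j<Suc k. block_weight j) = (\<Prod>a<k. (T (Suc a) - T (Suc k)) / (T 0 - T (Suc a)))"
proof (induction k)
  case 0
  then show ?case by (simp add: block_weight_eq)
next
  case (Suc k)
  have "(\<Prod>j<Suc (Suc k). block_weight j) = block_weight (Suc k) *
    (\<Prod>a<k. (T (Suc a) - T (Suc k)) / (T 0 - T (Suc a)))"
    using Suc by (simp add: mult.commute)
  also have "block_weight (Suc k) = (\<Prod>i<Suc k. T (Suc i) - T (Suc (Suc k)))
     / ((T 0 - T (Suc k)) * (\<Prod>i<k. T (Suc i) - T (Suc k)))"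
    unfolding block_weight_eq prod_dividef
    by (subst (2) prod.lessThan_Suc_shift) simp
  finally show ?case
    by (simp add: prod_dividef)
qed

section \<open>Vandermonde determinants\<close>

text \<open>
  The node list carries the order of the nodes and hence the sign of the product.
\<close>

fun vandermonde_prod :: "'a :: comm_ring_1 list \<Rightarrow> 'a" where
  "vandermonde_prod [] = 1"
| "vandermonde_prod (x # xs) = (\<Prod>y\<leftarrow>xs. y - x) * vandermonde_prod xs"

text \<open>
  This isolates the single node in which the numerator and denominator of a hook Schur function differ.
\<close>

lemma vandermonde_prod_insert:
  "vandermonde_prod (ys @ x # zs)
    = (\<Prod>y\<leftarrow>ys. x - y) * (\<Prod>z\<leftarrow>zs. z - x) * vandermonde_prod (ys @ zs)"
  by (induction ys) (simp_all add: ac_simps)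

lemma vandermonde_prod_nonzero:
  fixes xs :: "'a :: idom list"
  shows "distinct xs \<Longrightarrow> vandermonde_prod xs \<noteq> 0"
  by (induction xs) (auto simp: prod_list_zero_iff)

text \<open>
  Subtracting \<open>x\<close> times each row from the next one (multiplication by the unitriangular matrix \<open>L\<close>) clears the
  column of the first node \<open>x\<close> below its top entry.  What remains is the Vandermonde
  matrix \<open>B\<close> of the other nodes with the column of each node \<open>y\<close> scaled by \<open>y - x\<close>.
\<close>

lemma det_vandermonde:
  fixes xs :: "'a :: field list"
  shows "det (mat (length xs) (length xs) (\<lambda>(i, j). (xs ! j) ^ i)) = vandermonde_prod xs"
proof (induction xs)
  case (Cons x xs)
  let ?n = "length xs"
  define A where "A = mat (Suc ?n) (Suc ?n) (\<lambda>(i, j). ((x # xs) ! j) ^ i)"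
  define L where "L = mat (Suc ?n) (Suc ?n)
    (\<lambda>(i, j). if j = i then 1 else if Suc j = i then - x else 0)"
  define B where "B = mat ?n ?n (\<lambda>(i, j). (xs ! j) ^ i)"
  define D where "D = mat ?n ?n (\<lambda>(i, j). if i = j then xs ! j - x else 0)"
  have carrier: "A \<in> carrier_mat (Suc ?n) (Suc ?n)" "L \<in> carrier_mat (Suc ?n) (Suc ?n)"
    "B \<in> carrier_mat ?n ?n" "D \<in> carrier_mat ?n ?n"
    by (simp_all add: A_def L_def B_def D_def)
  have "det L = prod_list (diag_mat L)"
    by (rule det_lower_triangular[OF _ carrier(2)]) (auto simp: L_def)
  also have "diag_mat L = replicate (Suc ?n) 1"
    by (rule nth_equalityI) (auto simp: diag_mat_def L_def simp del: upt_Suc replicate_Suc)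
  finally have det_L: "det L = 1" by simp
  have "det D = prod_list (diag_mat D)"
    by (rule det_upper_triangular[OF _ carrier(4)]) (auto simp: D_def)
  also have "diag_mat D = map (\<lambda>y. y - x) xs"
    by (rule nth_equalityI) (auto simp: diag_mat_def D_def)
  finally have det_D: "det D = (\<Prod>y\<leftarrow>xs. y - x)" .
  have LA: "(L * A) $$ (i, j) = (if i = 0 then 1 else ((x # xs) ! j) ^ (i - 1) * ((x # xs) ! j - x))"
    if "i < Suc ?n" "j < Suc ?n" for i j
  proof -
    have "(L * A) $$ (i, j) = (\<Sum>l<Suc ?n. L $$ (i, l) * A $$ (l, j))"
      using that carrier by (simp add: scalar_prod_def atLeast0LessThan)
    also have "\<dots> = (\<Sum>l<Suc ?n. (if l = i then ((x # xs) ! j) ^ l else 0)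
        + (if i \<noteq> 0 \<and> l = i - 1 then - x * ((x # xs) ! j) ^ l else 0))"
      using that by (intro sum.cong) (auto simp: L_def A_def)
    also have "\<dots> = (if i = 0 then 1 else ((x # xs) ! j) ^ (i - 1) * ((x # xs) ! j - x))"
      using that by (cases i) (simp_all add: sum.distrib algebra_simps del: sum.lessThan_Suc)
    finally show ?thesis .
  qed
  have BD: "(B * D) $$ (i, j) = (xs ! j) ^ i * (xs ! j - x)" if "i < ?n" "j < ?n" for i j
  proof -
    have "(B * D) $$ (i, j) = (\<Sum>l<?n. B $$ (i, l) * D $$ (l, j))"
      using that carrier by (simp add: scalar_prod_def atLeast0LessThan)
    also have "\<dots> = (\<Sum>l<?n. if l = j then (xs ! j) ^ i * (xs ! j - x) else 0)"
      using that by (intro sum.cong) (auto simp: B_def D_def)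
    finally show ?thesis using that by simp
  qed
  have "L * A = four_block_mat (1\<^sub>m 1) (mat 1 ?n (\<lambda>_. 1)) (0\<^sub>m ?n 1) (B * D)"
    using carrier by (intro eq_matI) (auto simp: LA BD simp del: index_mult_mat(1))
  then have "det (L * A) = det (B * D)"
    using carrier by (subst (asm) (1) refl) (simp add: det_four_block_mat_lower_left_zero[of _ 1 _ ?n])
  then show ?case
    using det_mult[OF carrier(2,1)] det_mult[OF carrier(3,4)] Cons det_L det_D
    by (simp add: A_def B_def)
qed simp

section \<open>Weights of Grassmannian permutations\<close>

lemma wt_one [simp]: "N \<le> 1 \<Longrightarrow> wt N w = 1"
  by (simp add: wt.simps)

lemma block_weight_0 [simp]: "block_weight 0 = 1"
  by (simp add: block_weight_eq)

text \<open>
  The recursion of the weight for a known factorization.  Since weights are 1 for \<open>N \<le> 1\<close>, it holds for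
  \<open>N = 1\<close> as well, which spares a case distinction in the inductions below.
\<close>

lemma wt_factorization:
  assumes "w permutes {1..N}" "p < N" "w (Suc p) = 1" "factorization N p w (lam, a, b)"
  shows "wt N w = block_weight p * phi (wt (N - 1) (u_perm (N - 1) p (map (\<lambda>x. x - 1) lam)))
    * wt p a * (phi ^^ Suc p) (wt (N - Suc p) (\<lambda>i. b (i + Suc p) - Suc p))"
proof (cases "N \<le> 1")
  case True
  then have "p = 0" using assms(2) by simp
  with True show ?thesis by (simp add: phi_1)
next
  case False
  have p: "inv_into UNIV w 1 - 1 = p"
    using inv_f_eq[OF permutes_inj[OF assms(1)] assms(3)] by simp
  have "(THE f. factorization N p w f) = (lam, a, b)"
    using factorization_ex1(1)[OF assms(1) _ p[symmetric]] assms(2,4) by (intro the1_equality) auto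
  with False show ?thesis
    using assms(1) by (subst wt.simps) (simp add: Let_def block_weight_def p del: One_nat_def, simp)
qed

lemma u_perm_eqI:
  assumes "in_rectangle p (N - p) lam" "p \<le> N" "grassmannian N p u"
    and "\<And>i. 1 \<le> i \<Longrightarrow> i \<le> p \<Longrightarrow> u i = lam ! (p - i) + i"
  shows "u_perm N p lam = u"
  unfolding u_perm_def
  by (rule the1_equality[OF u_perm_ex1[OF assms(1,2)]]) (use assms(3,4) in auto)

lemma grassmannian_id: "grassmannian N p id"
  by (simp add: grassmannian_def permutes_id strict_mono_on_def)

lemma in_rectangle_replicate_0: "in_rectangle p m (replicate p 0)"
  by (simp add: in_rectangle_def sorted_wrt_iff_nth_less)

lemma u_perm_replicate_0: "p \<le> N \<Longrightarrow> u_perm N p (replicate p 0) = id"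
  by (rule u_perm_eqI) (auto simp: grassmannian_id in_rectangle_replicate_0)

lemma u_perm_Nil: "u_perm N 0 [] = id"
  using u_perm_replicate_0[of 0 N] by simp

lemma wt_id: "wt N id = 1"
proof (induction N)
  case (Suc N)
  have "factorization (Suc N) 0 id ([], id, id)"
    by (simp add: factorization_def in_rectangle_def permutes_id u_perm_Nil)
  then have "wt (Suc N) id = block_weight 0 * phi (wt N (u_perm N 0 [])) * wt 0 id *
      phi (wt N (\<lambda>i. i))"
    using wt_factorization[of id "Suc N" 0 "[]" id id] by (simp add: permutes_id)
  with Suc show ?case by (simp add: u_perm_Nil phi_1 flip: id_def)
qed simp

lemma map_Suc_pred: "0 \<notin> set xs \<Longrightarrow> map Suc (map (\<lambda>x. x - 1) xs) = xs"
  by (induction xs) auto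

lemma in_rectangle_map_Suc:
  "in_rectangle k (Suc M) (map Suc lam) \<longleftrightarrow> in_rectangle k M lam"
  by (simp add: in_rectangle_def sorted_wrt_map)

lemma in_rectangle_snoc_0:
  "in_rectangle (Suc k) M (lam @ [0]) \<longleftrightarrow> in_rectangle k M lam"
  by (auto simp: in_rectangle_def sorted_wrt_append)

text \<open>
  The dichotomy behind the Pascal recurrence: whether the Young diagram, with \<open>k + 1\<close> rows, has a full first column.
\<close>

lemma in_rectangle_cases:
  "{lam. in_rectangle (Suc k) (Suc M) lam} = (\<lambda>lam. lam @ [0]) ` {lam. in_rectangle k (Suc M) lam}
    \<union> map Suc ` {lam. in_rectangle (Suc k) M lam}" (is "?L = ?R")
proof
  show "?R \<subseteq> ?L"
    by (auto simp: in_rectangle_map_Suc in_rectangle_snoc_0)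
  show "?L \<subseteq> ?R"
  proof
    fix lam assume "lam \<in> ?L"
    then have lam: "in_rectangle (Suc k) (Suc M) lam" by simp
    then obtain ys y where ys: "lam = ys @ [y]"
      by (cases lam rule: rev_exhaust) (auto simp: in_rectangle_def)
    show "lam \<in> ?R"
    proof (cases "y = 0")
      case True
      then show ?thesis using lam ys by (auto simp: in_rectangle_snoc_0)
    next
      case False
      then have "0 \<notin> set lam"
        using lam ys by (fastforce simp: in_rectangle_def sorted_wrt_append)
      then have "lam = map Suc (map (\<lambda>x. x - 1) lam)"
        by (rule map_Suc_pred[symmetric])
      then show ?thesis using lam in_rectangle_map_Suc by (metis UnI2 imageI mem_Collect_eq)
    qed
  qed
qed

lemma finite_in_rectangle: "finite {lam. in_rectangle k M lam}"
  by (rule finite_subset[OF _ finite_lists_length_eq[of "{..M}" k]]) (auto simp: in_rectangle_def)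

lemma in_rectangle_nothing_0: "in_rectangle k 0 lam \<longleftrightarrow> lam = replicate k 0"
  by (auto simp: in_rectangle_def replicate_eqI sorted_wrt_iff_nth_less)

text \<open>
  When no part vanishes, every value on \<open>{1..p}\<close> exceeds 1, so the value 1 is the least one
  of the second increasing block.
\<close>

lemma u_perm_map_Suc_1:
  assumes "in_rectangle p (N - p) lam" "p \<le> N"
  shows "u_perm (Suc N) p (map Suc lam) (Suc p) = 1"
proof -
  let ?u = "u_perm (Suc N) p (map Suc lam)"
  have len: "length lam = p" using assms by (simp add: in_rectangle_def)
  have rect: "in_rectangle p (Suc N - p) (map Suc lam)"
    using assms by (simp add: Suc_diff_le in_rectangle_map_Suc)
  have u: "grassmannian (Suc N) p ?u" and u_le: "\<And>i. i \<in> {1..p} \<Longrightarrow> ?u i = map Suc lam ! (p - i) + i"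
    using u_perm_grassmannian[OF rect] u_perm_apply[OF rect] assms(2) by simp_all
  have perm: "?u permutes {1..Suc N}" and mono: "strict_mono_on {p+1..Suc N} ?u"
    using u by (auto simp: grassmannian_def)
  obtain j where j: "j \<in> {1..Suc N}" "?u j = 1"
    using permutes_image[OF perm] by (metis atLeastAtMost_iff imageE le_add1 order_refl plus_1_eq_Suc)
  have "\<not> j \<le> p"
    using u_le[of j] j by (auto simp: len)
  then have "?u (p + 1) + (j - (p + 1)) \<le> ?u j"
    using strict_mono_on_gap[OF mono, of "p + 1" j] j by auto
  moreover have "?u (Suc p) \<in> {1..Suc N}"
    using permutes_in_image[OF perm, of "Suc p"] assms(2) by simp
  ultimately show ?thesis using j by simp
qed

text \<open>
  The case \<open>b = id\<close> of the weight recursion.  It serves twice: with \<open>a = id\<close> for Grassmannian permutations, and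
  with \<open>a\<close> a reversal for hook ribbons.
\<close>

lemma wt_u_perm_map_Suc:
  assumes "in_rectangle p (N - p) lam" "p \<le> N" "a permutes {1..p}"
  shows "wt (Suc N) (u_perm (Suc N) p (map Suc lam) \<circ> a)
    = block_weight p * phi (wt N (u_perm N p lam)) * wt p a"
proof -
  let ?u = "u_perm (Suc N) p (map Suc lam)"
  have rect: "in_rectangle p (Suc N - p) (map Suc lam)"
    using assms by (simp add: Suc_diff_le in_rectangle_map_Suc)
  have "?u permutes {1..Suc N}"
    using u_perm_grassmannian[OF rect] assms(2) by (simp add: grassmannian_def)
  moreover have "a permutes {1..Suc N}"
    using assms by (auto intro: permutes_subset)
  ultimately have perm: "?u \<circ> a permutes {1..Suc N}" by (rule permutes_compose[rotated])
  have "factorization (Suc N) p (?u \<circ> a) (map Suc lam, a, id)"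
    using rect assms by (simp add: factorization_def permutes_id)
  moreover have "(?u \<circ> a) (Suc p) = 1"
    using u_perm_map_Suc_1[OF assms(1,2)] permutes_not_in[OF assms(3), of "Suc p"] by simp
  moreover have "(\<lambda>i. id (i + Suc p) - Suc p) = id" by auto
  moreover have "(phi ^^ d) 1 = 1" for d by (induction d) (simp_all add: phi_1)
  ultimately show ?thesis
    using wt_factorization[OF perm, of p "map Suc lam" a id] assms(2)
    by (simp add: wt_id phi_1 o_def)
qed

text \<open>
  A vanishing last part means that 1 is a fixed point.  In the weight recursion then \<open>p = 0\<close>, and \<open>b\<close> is the
  whole permutation; moved down by one it is the Grassmannian permutation of the shorter partition.
\<close>

lemma wt_u_perm_snoc_0:
  assumes "in_rectangle p (N - p) lam" "p \<le> N"
  shows "wt (Suc N) (u_perm (Suc N) (Suc p) (lam @ [0])) = phi (wt N (u_perm N p lam))"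
proof -
  let ?u = "u_perm (Suc N) (Suc p) (lam @ [0])"
  have len: "length lam = p" using assms by (simp add: in_rectangle_def)
  have rect: "in_rectangle (Suc p) (Suc N - Suc p) (lam @ [0])"
    using assms by (simp add: in_rectangle_snoc_0)
  have gr: "grassmannian (Suc N) (Suc p) ?u"
    and app: "\<And>i. i \<in> {1..Suc p} \<Longrightarrow> ?u i = (lam @ [0]) ! (Suc p - i) + i"
    using u_perm_grassmannian[OF rect] u_perm_apply[OF rect] assms(2) by simp_all
  have perm: "?u permutes {1..Suc N}" using gr by (simp add: grassmannian_def)
  have u1: "?u 1 = 1" using app[of 1] len by (simp add: nth_append)
  have perm2: "?u permutes {2..Suc N}"
  proof -
    have "?u permutes ({1..Suc N} - {1})"
    proof (rule permutes_superset[OF perm])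
      fix x assume "x \<in> {1..Suc N} - ({1..Suc N} - {1})"
      then show "?u x = x" using u1 by auto
    qed
    moreover have "{1..Suc N} - {1} = {2..Suc N}" by auto
    ultimately show ?thesis by simp
  qed
  \<comment> \<open>\<open>?v\<close> has the form in which \<open>wt_factorization\<close> presents \<open>b\<close> for \<open>p = 0\<close>.\<close>
  let ?v = "\<lambda>i. ?u (i + Suc 0) - Suc 0"
  have u_ge: "?u (Suc i) \<in> {2..Suc N}" if "i \<in> {1..N}" for i
    using permutes_in_image[OF perm2, of "Suc i"] that by auto
  have "grassmannian N p ?v"
    unfolding grassmannian_def
  proof (intro conjI)
    show "?v permutes {1..N}"
    proof (rule bij_imp_permutes)
      have "inj_on ?v {1..N}"
      proof (rule inj_onI)
        fix i j assume ij: "i \<in> {1..N}" "j \<in> {1..N}" "?v i = ?v j"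
        then have "?u (Suc i) = ?u (Suc j)" using u_ge[of i] u_ge[of j] by auto
        then show "i = j" using injD[OF permutes_inj[OF perm]] by blast
      qed
      moreover have "?v ` {1..N} \<subseteq> {1..N}"
        using u_ge by fastforce
      ultimately show "bij_betw ?v {1..N} {1..N}"
        by (simp add: bij_betw_def endo_inj_surj)
      show "?v i = i" if "i \<notin> {1..N}" for i
        using that u1 permutes_not_in[OF perm, of "Suc i"] by (cases "i = 0") auto
    qed
    have mono: "strict_mono_on {1..Suc p} ?u" "strict_mono_on {Suc p + 1..Suc N} ?u"
      using gr by (auto simp: grassmannian_def)
    show "strict_mono_on {1..p} ?v"
    proof (rule strict_mono_onI)
      fix i j assume ij: "i \<in> {1..p}" "j \<in> {1..p}" "i < j"
      then have "?u (Suc i) < ?u (Suc j)"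
        by (intro strict_mono_onD[OF mono(1)]) auto
      then show "?v i < ?v j" using u_ge[of i] ij assms(2) by auto
    qed
    show "strict_mono_on {p + 1..N} ?v"
    proof (rule strict_mono_onI)
      fix i j assume ij: "i \<in> {p + 1..N}" "j \<in> {p + 1..N}" "i < j"
      then have "?u (Suc i) < ?u (Suc j)"
        by (intro strict_mono_onD[OF mono(2)]) auto
      then show "?v i < ?v j" using u_ge[of i] ij by auto
    qed
  qed
  then have v: "u_perm N p lam = ?v"
    using assms len app by (intro u_perm_eqI) (auto simp: nth_append)
  have "factorization (Suc N) 0 ?u ([], id, ?u)"
    using perm2 by (simp add: factorization_def in_rectangle_def permutes_id u_perm_Nil numeral_2_eq_2)
  then show ?thesis
    using wt_factorization[OF perm, of 0 "[]" id ?u] u1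
    by (simp add: u_perm_Nil wt_id phi_1 v)
qed

text \<open>
  The splitting \<open>in_rectangle_cases\<close> turns the sum into the two terms of the
  \<open>(q,t)\<close>-Pascal recurrence.  Degenerate rectangles contain the empty partition alone.
\<close>

theorem sum_wt_u_perm:
  "(\<Sum>lam | in_rectangle k M lam. wt (k + M) (u_perm (k + M) k lam)) = qt_binomial (k + M) k"
proof (induction "k + M" arbitrary: k M)
  case 0
  then show ?case by (simp add: in_rectangle_nothing_0 qt_binomial_eq)
next
  case (Suc N)
  show ?case
  proof (cases "k = 0 \<or> M = 0")
    case True
    then have "{lam. in_rectangle k M lam} = {replicate k 0}"
      by (auto simp: in_rectangle_nothing_0) (auto simp: in_rectangle_def)
    moreover have "qt_binomial (k + M) k = 1"
      using True by (auto simp: qt_binomial_eq)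
    ultimately show ?thesis by (simp add: u_perm_replicate_0 wt_id)
  next
    case False
    then obtain k' M' where kM: "k = Suc k'" "M = Suc M'" by (metis not0_implies_Suc)
    have N: "N = k' + M" "N = k + M'" "k' < N" using Suc.hyps(2) kM by auto
    let ?w = "\<lambda>lam. wt (Suc N) (u_perm (Suc N) k lam)"
    have "(\<Sum>lam | in_rectangle k M lam. ?w lam)
        = (\<Sum>lam | in_rectangle k' M lam. ?w (lam @ [0]))
          + (\<Sum>lam | in_rectangle k M' lam. ?w (map Suc lam))"
      unfolding kM in_rectangle_cases
      by (subst sum.union_disjoint)
        (auto simp: finite_in_rectangle sum.reindex inj_on_def o_def Suc_neq_Zero append_eq_map_conv)
    also have "(\<Sum>lam | in_rectangle k' M lam. ?w (lam @ [0])) = phi (qt_binomial N k')"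
      using Suc.hyps(1)[OF N(1)] wt_u_perm_snoc_0[of k' N] N kM by (simp flip: phi_sum)
    also have "(\<Sum>lam | in_rectangle k M' lam. ?w (map Suc lam))
        = block_weight k * phi (\<Sum>lam | in_rectangle k M' lam. wt N (u_perm N k lam))"
    proof -
      have "?w (map Suc lam) = block_weight k * phi (wt N (u_perm N k lam))"
        if "in_rectangle k M' lam" for lam
        using wt_u_perm_map_Suc[of k N lam id] that N(2) by (simp add: permutes_id wt_id)
      then show ?thesis by (simp add: phi_sum sum_distrib_left)
    qed
    also have "(\<Sum>lam | in_rectangle k M' lam. wt N (u_perm N k lam)) = qt_binomial N k"
      using Suc.hyps(1)[OF N(2)] unfolding N(2)[symmetric] .
    finally show ?thesis
      using qt_binomial_Suc_Suc[OF N(3)] Suc.hyps(2) kM by simp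
  qed
qed

section \<open>Hook-shaped ribbons\<close>

lemma run_lengths_pos: "xs \<noteq> [] \<Longrightarrow> run_lengths xs \<noteq> [] \<and> 0 \<notin> set (run_lengths xs)"
  by (induction xs rule: run_lengths.induct) (auto dest: list.set_sel(2)[rotated])

text \<open>
  An initial run of length 1 ends at a non-ascent, so the composition \<open>(1^k, M + 1)\<close> says that the list descends \<open>k\<close>
  times and ascends afterwards.  Equal neighbours count as descents here; they do not occur in permutations.
\<close>

lemma run_lengths_eq_hook_iff:
  "run_lengths xs = replicate k 1 @ [Suc M] \<longleftrightarrow> length xs = Suc (k + M) \<and>
    (\<forall>i<k. xs ! Suc i \<le> xs ! i) \<and> (\<forall>i. k \<le> i \<longrightarrow> i < k + M \<longrightarrow> xs ! i < xs ! Suc i)"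
proof (induction xs arbitrary: k M rule: run_lengths.induct)
  case (2 x)
  then show ?case by (cases k) auto
next
  case (3 x y zs)
  obtain r rs where r: "run_lengths (y # zs) = r # rs" "0 < r"
    using run_lengths_pos[of "y # zs"] by (cases "run_lengths (y # zs)") auto
  show ?case
  proof (cases k)
    case 0
    show ?thesis
    proof (cases M)
      case 0
      with \<open>k = 0\<close> r show ?thesis by auto
    next
      case (Suc M')
      have "run_lengths (x # y # zs) = [Suc M] \<longleftrightarrow> x < y \<and> run_lengths (y # zs) = replicate 0 1 @ [Suc M']"
        using r Suc by auto
      also have "\<dots> \<longleftrightarrow> x < y \<and> length (y # zs) = Suc M'
          \<and> (\<forall>i<M'. (y # zs) ! i < (y # zs) ! Suc i)"
        by (cases "x < y") (simp_all only: 3 simp_thms, simp)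
      also have "\<dots> \<longleftrightarrow> length (x # y # zs) = Suc M
          \<and> (\<forall>i<M. (x # y # zs) ! i < (x # y # zs) ! Suc i)"
        unfolding Suc All_less_Suc2 by auto
      finally show ?thesis using \<open>k = 0\<close> by simp
    qed
  next
    case (Suc k')
    have "run_lengths (x # y # zs) = replicate k 1 @ [Suc M]
        \<longleftrightarrow> \<not> x < y \<and> run_lengths (y # zs) = replicate k' 1 @ [Suc M]"
      using r Suc by auto
    also have "\<dots> \<longleftrightarrow> y \<le> x \<and> length (y # zs) = Suc (k' + M) \<and>
        (\<forall>i<k'. (y # zs) ! Suc i \<le> (y # zs) ! i) \<and>
        (\<forall>i. k' \<le> i \<longrightarrow> i < k' + M \<longrightarrow> (y # zs) ! i < (y # zs) ! Suc i)"
      by (cases "x < y") (simp_all only: 3 simp_thms not_less, simp_all)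
    also have "(\<forall>i. k' \<le> i \<longrightarrow> i < k' + M \<longrightarrow> (y # zs) ! i < (y # zs) ! Suc i) \<longleftrightarrow>
        (\<forall>i. k \<le> i \<longrightarrow> i < k + M \<longrightarrow> (x # y # zs) ! i < (x # y # zs) ! Suc i)"
    proof (intro iffI allI impI)
      fix i assume *: "\<forall>i. k' \<le> i \<longrightarrow> i < k' + M \<longrightarrow> (y # zs) ! i < (y # zs) ! Suc i"
        "k \<le> i" "i < k + M"
      then obtain j where "i = Suc j" using Suc by (cases i) auto
      with * show "(x # y # zs) ! i < (x # y # zs) ! Suc i" using Suc by simp
    next
      fix i assume *: "\<forall>i. k \<le> i \<longrightarrow> i < k + M \<longrightarrow> (x # y # zs) ! i < (x # y # zs) ! Suc i"
        "k' \<le> i" "i < k' + M"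
      then show "(y # zs) ! i < (y # zs) ! Suc i"
        using Suc *(1)[rule_format, of "Suc i"] by simp
    qed
    finally show ?thesis
      unfolding Suc All_less_Suc2 by auto
  qed
qed auto

lemma strict_mono_on_Suc:
  fixes f :: "nat \<Rightarrow> nat"
  assumes "\<And>i. a \<le> i \<Longrightarrow> i < b \<Longrightarrow> f i < f (Suc i)"
  shows "strict_mono_on {a..b} f"
proof (rule strict_mono_onI)
  fix i j assume "i \<in> {a..b}" "j \<in> {a..b}" "i < j"
  from \<open>i < j\<close> \<open>j \<in> {a..b}\<close> show "f i < f j"
  proof (induction j)
    case (Suc j)
    then show ?case
      using assms[of j] \<open>i \<in> {a..b}\<close> by (cases "i = j") auto
  qed simp
qed

definition reverse_initial :: "nat \<Rightarrow> nat \<Rightarrow> nat"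
  where "reverse_initial k i = (if 1 \<le> i \<and> i \<le> k then Suc k - i else i)"

lemma reverse_initial_involution: "reverse_initial k (reverse_initial k i) = i"
  by (auto simp: reverse_initial_def)

lemma reverse_initial_comp [simp]: "reverse_initial k \<circ> reverse_initial k = id"
  by (simp add: fun_eq_iff reverse_initial_involution)

lemma reverse_initial_permutes: "reverse_initial k permutes {1..k}"
  unfolding permutes_def
  by (metis atLeastAtMost_iff reverse_initial_def reverse_initial_involution)

lemma reverse_initial_permutes_le: "k \<le> N \<Longrightarrow> reverse_initial k permutes {1..N}"
  by (rule permutes_subset[OF reverse_initial_permutes]) auto

text \<open>
  Reversing the initial descent makes the first \<open>k\<close> entries increase, which gives a Grassmannian permutation.
  The descent from position \<open>k\<close> to \<open>k + 1\<close> is not visible in it; that descent is encoded by \<open>w (Suc k) = 1\<close>.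
\<close>

lemma descent_composition_hook_iff:
  assumes "w permutes {1..Suc (k + M)}"
  shows "descent_composition (Suc (k + M)) w = replicate k 1 @ [Suc M] \<longleftrightarrow>
    grassmannian (Suc (k + M)) k (w \<circ> reverse_initial k) \<and> w (Suc k) = 1"
    (is "?L \<longleftrightarrow> ?R")
proof -
  let ?N = "Suc (k + M)" and ?r = "reverse_initial k"
  have inj: "w i = w j \<longleftrightarrow> i = j" for i j
    using injD[OF permutes_inj[OF assms]] by blast
  have in_range: "w i \<in> {1..?N} \<longleftrightarrow> i \<in> {1..?N}" for i
    using assms by (rule permutes_in_image)
  have nth: "map w [1..<?N + 1] ! i = w (Suc i)" if "i < ?N" for i
    using that by (simp del: upt_Suc)
  have L_iff: "?L \<longleftrightarrow> (\<forall>i<k. w (Suc (Suc i)) \<le> w (Suc i)) \<and>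
      (\<forall>i. k \<le> i \<longrightarrow> i < k + M \<longrightarrow> w (Suc i) < w (Suc (Suc i)))"
    unfolding descent_composition_def run_lengths_eq_hook_iff
    by (auto simp: nth simp del: upt_Suc)
  show ?thesis
  proof
    assume ?L
    then have dec: "\<And>i. i < k \<Longrightarrow> w (Suc (Suc i)) < w (Suc i)"
      and inc: "\<And>i. k \<le> i \<Longrightarrow> i < k + M \<Longrightarrow> w (Suc i) < w (Suc (Suc i))"
      unfolding L_iff using inj by (auto simp: le_less)
    have "w \<circ> ?r permutes {1..?N}"
      by (intro permutes_compose assms reverse_initial_permutes_le) simp
    moreover have "strict_mono_on {1..k} (w \<circ> ?r)"
    proof (rule strict_mono_on_Suc)
      fix i assume "1 \<le> i" "i < k"
      then show "(w \<circ> ?r) i < (w \<circ> ?r) (Suc i)"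
        using dec[of "k - Suc i"] by (simp add: reverse_initial_def Suc_diff_Suc Suc_diff_le)
    qed
    moreover have "strict_mono_on {k + 1..?N} (w \<circ> ?r)"
    proof (rule strict_mono_on_Suc)
      fix i assume "k + 1 \<le> i" "i < ?N"
      then show "(w \<circ> ?r) i < (w \<circ> ?r) (Suc i)"
        using inc[of "i - 1"] by (simp add: reverse_initial_def)
    qed
    \<comment> \<open>The value 1 cannot be taken where a smaller value follows or precedes.\<close>
    moreover have "w (Suc k) = 1"
    proof -
      obtain j where j: "j \<in> {1..?N}" "w j = 1"
        using permutes_image[OF assms] by (metis atLeastAtMost_iff imageE le_add1 order_refl plus_1_eq_Suc)
      have "j = Suc k"
      proof (rule ccontr)
        assume "j \<noteq> Suc k"
        then consider "j \<le> k" | "Suc k < j" by linarith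
        then show False
        proof cases
          case 1
          then have "w (Suc (Suc (j - 1))) < w (Suc (j - 1))" using j by (intro dec) auto
          then show False using 1 in_range[of "Suc j"] j by auto
        next
          case 2
          then have "w (Suc (j - 2)) < w (Suc (Suc (j - 2)))" using j by (intro inc) auto
          moreover have "Suc (Suc (j - 2)) = j" "Suc (j - 2) \<in> {1..?N}" using 2 j by auto
          ultimately show False using in_range[of "Suc (j - 2)"] j by auto
        qed
      qed
      with j show ?thesis by simp
    qed
    ultimately show ?R by (simp add: grassmannian_def)
  next
    assume ?R
    then have mono: "strict_mono_on {1..k} (w \<circ> ?r)" "strict_mono_on {k + 1..?N} (w \<circ> ?r)"
      and w1: "w (Suc k) = 1"
      by (auto simp: grassmannian_def)
    have "w (Suc (Suc i)) \<le> w (Suc i)" if "i < k" for i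
    proof (cases "Suc i = k")
      case True
      then show ?thesis using w1 in_range[of "Suc i"] by auto
    next
      case False
      then have "(w \<circ> ?r) (k - Suc i) < (w \<circ> ?r) (k - i)"
        using that by (intro strict_mono_onD[OF mono(1)]) auto
      moreover have "?r (k - Suc i) = Suc (Suc i)" "?r (k - i) = Suc i"
        using that False by (auto simp: reverse_initial_def)
      ultimately show ?thesis by simp
    qed
    moreover have "w (Suc i) < w (Suc (Suc i))" if "k \<le> i" "i < k + M" for i
    proof -
      have "(w \<circ> ?r) (Suc i) < (w \<circ> ?r) (Suc (Suc i))"
        using that by (intro strict_mono_onD[OF mono(2)]) auto
      then show ?thesis using that by (simp add: reverse_initial_def)
    qed
    ultimately show ?L unfolding L_iff by blast
  qed
qed

lemma grassmannian_eq_u_perm: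
  assumes "grassmannian (Suc N) p u" "u (Suc p) = 1" "p \<le> N"
  obtains lam where "in_rectangle p (N - p) lam" "u = u_perm (Suc N) p (map Suc lam)"
proof -
  have perm: "u permutes {1..Suc N}" using assms(1) by (simp add: grassmannian_def)
  obtain mu a b where f: "factorization (Suc N) p u (mu, a, b)"
    using ex_factorization[of p "Suc N" u] perm assms by auto
  then have rect: "in_rectangle p (Suc N - p) mu" by (simp add: factorization_def)
  have u: "u = u_perm (Suc N) p mu"
    using factorization_image(1)[OF f] u_perm_grassmannian[OF rect] assms
    by (intro grassmannian_unique[of "Suc N" p]) auto
  have "0 \<notin> set mu"
    using factorization_parts_nonzero[OF f _ perm] assms by simp
  then have mu: "mu = map Suc (map (\<lambda>x. x - 1) mu)"
    by (rule map_Suc_pred[symmetric])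
  show ?thesis
  proof (rule that)
    show "u = u_perm (Suc N) p (map Suc (map (\<lambda>x. x - 1) mu))" using u mu by simp
    show "in_rectangle p (N - p) (map (\<lambda>x. x - 1) mu)"
      using rect mu assms(3) in_rectangle_map_Suc by (metis Suc_diff_le)
  qed
qed

text \<open>
  Reversing \<open>{1..k+1}\<close> amounts to reversing \<open>{1..k}\<close> and then applying the Grassmannian permutation of \<open>(1^k)\<close>.
  Removing the first column of \<open>(1^k)\<close> leaves the empty partition, so each step contributes one block factor.
\<close>

lemma wt_reverse_initial: "wt k (reverse_initial k) = (\<Prod>j<k. block_weight j)"
proof (induction k)
  case (Suc k)
  let ?c = "reverse_initial (Suc k) \<circ> reverse_initial k"
  have c: "?c i = (if 1 \<le> i \<and> i \<le> k then Suc i else if i = Suc k then 1 else i)" for i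
    by (auto simp: reverse_initial_def)
  have "?c permutes {1..Suc k}"
    by (intro permutes_compose reverse_initial_permutes reverse_initial_permutes_le) simp
  then have "grassmannian (Suc k) k ?c"
    unfolding grassmannian_def by (auto simp: c strict_mono_on_def simp del: o_apply)
  then have "u_perm (Suc k) k (map Suc (replicate k 0)) = ?c"
    using in_rectangle_replicate_0[of k 0]
    by (intro u_perm_eqI) (auto simp: c in_rectangle_map_Suc simp del: o_apply map_replicate)
  moreover have "reverse_initial (Suc k) = ?c \<circ> reverse_initial k"
    by (simp add: o_assoc[symmetric])
  ultimately have "wt (Suc k) (reverse_initial (Suc k))
      = block_weight k * phi (wt k (u_perm k k (replicate k 0))) * wt k (reverse_initial k)"
    using wt_u_perm_map_Suc[of k k "replicate k 0" "reverse_initial k"]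
      in_rectangle_replicate_0[of k 0] reverse_initial_permutes by simp
  with Suc show ?case by (simp add: u_perm_replicate_0 wt_id phi_1 mult.commute)
qed simp

text \<open>
  The parametrization of the permutations counted by a hook ribbon, from which the ribbon number becomes a
  sum over partitions.  It is injective because factorizations are unique.
\<close>

lemma hook_ribbon_permutations:
  "{w. w permutes {1..Suc (k + M)} \<and>
      descent_composition (Suc (k + M)) w = replicate k 1 @ [Suc M]}
    = (\<lambda>lam. u_perm (Suc (k + M)) k (map Suc lam) \<circ> reverse_initial k)
        ` {lam. in_rectangle k M lam}" (is "?L = ?f ` ?R")
proof
  let ?N = "Suc (k + M)"
  show "?L \<subseteq> ?f ` ?R"
  proof
    fix w assume w: "w \<in> ?L"
    then have gr: "grassmannian ?N k (w \<circ> reverse_initial k)" and w1: "w (Suc k) = 1"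
      using descent_composition_hook_iff[of w k M] by auto
    obtain lam where lam: "in_rectangle k (k + M - k) lam"
        "w \<circ> reverse_initial k = u_perm ?N k (map Suc lam)"
      by (rule grassmannian_eq_u_perm[OF gr]) (use w1 in \<open>simp_all add: reverse_initial_def\<close>)
    have "w = w \<circ> reverse_initial k \<circ> reverse_initial k"
      by (simp add: o_assoc[symmetric])
    also have "\<dots> = ?f lam" by (simp only: lam(2))
    finally show "w \<in> ?f ` ?R" using lam(1) by (intro image_eqI) simp_all
  qed
  show "?f ` ?R \<subseteq> ?L"
  proof (rule image_subsetI)
    fix lam assume "lam \<in> ?R"
    then have lam: "in_rectangle k M lam" by simp
    then have gr: "grassmannian ?N k (u_perm ?N k (map Suc lam))"
      by (intro u_perm_grassmannian) (simp_all add: Suc_diff_le in_rectangle_map_Suc)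
    then have perm: "?f lam permutes {1..?N}"
      by (intro permutes_compose reverse_initial_permutes_le) (simp_all add: grassmannian_def)
    moreover have "?f lam (Suc k) = 1"
      using u_perm_map_Suc_1[of k "k + M" lam] lam by (simp add: reverse_initial_def)
    moreover have "?f lam \<circ> reverse_initial k = u_perm ?N k (map Suc lam)"
      by (simp add: o_assoc[symmetric])
    ultimately show "?f lam \<in> ?L"
      using descent_composition_hook_iff[of "?f lam" k M] gr by simp
  qed
qed

lemma inj_on_u_perm_reverse:
  "inj_on (\<lambda>lam. u_perm (Suc (k + M)) k (map Suc lam) \<circ> reverse_initial k)
    {lam. in_rectangle k M lam}"
proof (rule inj_onI)
  let ?N = "Suc (k + M)"
  let ?f = "\<lambda>lam. u_perm ?N k (map Suc lam) \<circ> reverse_initial k"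
  have fact: "factorization ?N k (?f lam) (map Suc lam, reverse_initial k, id)"
    if "in_rectangle k M lam" for lam
    using that reverse_initial_permutes[of k]
    by (simp add: factorization_def permutes_id Suc_diff_le in_rectangle_map_Suc)
  fix lam mu
  assume "lam \<in> {lam. in_rectangle k M lam}" "mu \<in> {lam. in_rectangle k M lam}"
    and eq: "?f lam = ?f mu"
  then have "in_rectangle k M lam" "in_rectangle k M mu" by simp_all
  then have "map Suc lam = map Suc mu"
    using factorization_unique[OF fact[of lam] fact[of mu, folded eq]] by simp
  then show "lam = mu" by simp
qed

text \<open>
  The leading block factor completes the weight of the reversal of \<open>{1..k}\<close> to the telescoping product over
  \<open>j < k + 1\<close>; its numerators then cancel the denominators of the binomial coefficient.
\<close>

theorem ribbon_hook:
  "ribbon (replicate k 1 @ [Suc M])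
    = (\<Prod>a<k. (T (Suc a) - T (Suc (k + M))) / (T 0 - T (Suc a)))"
proof -
  have "ribbon (replicate k 1 @ [Suc M])
      = (\<Sum>lam | in_rectangle k M lam.
          wt (Suc (k + M)) (u_perm (Suc (k + M)) k (map Suc lam) \<circ> reverse_initial k))"
    unfolding ribbon_def
    using sum.reindex[OF inj_on_u_perm_reverse, of "wt (Suc (k + M))" k M]
    by (simp add: hook_ribbon_permutations sum_list_replicate o_def del: One_nat_def)
  also have "\<dots> = (\<Sum>lam | in_rectangle k M lam.
      block_weight k * phi (wt (k + M) (u_perm (k + M) k lam)) * wt k (reverse_initial k))"
    by (intro sum.cong refl wt_u_perm_map_Suc reverse_initial_permutes) simp_all
  also have "\<dots> = block_weight k * phi (qt_binomial (k + M) k) * wt k (reverse_initial k)"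
    by (simp add: sum_distrib_left sum_distrib_right phi_sum flip: sum_wt_u_perm)
  also have "\<dots> = phi (qt_binomial (k + M) k) * (\<Prod>j<Suc k. block_weight j)"
    by (simp add: wt_reverse_initial)
  also have "\<dots> = (\<Prod>a<k. (T (Suc a) - T (Suc (k + M))) / (T (Suc a) - T (Suc k)) *
      ((T (Suc a) - T (Suc k)) / (T 0 - T (Suc a))))"
    unfolding prod_block_weight prod.distrib
    by (simp add: qt_binomial_eq phi_simps flip: prod_dividef)
  also have "\<dots> = (\<Prod>a<k. (T (Suc a) - T (Suc (k + M))) / (T 0 - T (Suc a)))"
    by (intro prod.cong) auto
  finally show ?thesis .
qed

section \<open>Hook Schur functions\<close>

lemma det_alternant:
  assumes "length lam = N"
  shows "det (alternant N lam)
    = vandermonde_prod (map (\<lambda>j. T (lam ! j + (N - 1 - j))) [0..<N])"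
proof -
  let ?xs = "map (\<lambda>j. T (lam ! j + (N - 1 - j))) [0..<N]"
  have "alternant N lam = mat (length ?xs) (length ?xs) (\<lambda>(i, j). (?xs ! j) ^ i)"
    unfolding alternant_def by (intro eq_matI) (auto simp: tpow_qpow T_def)
  then show ?thesis using det_vandermonde[of ?xs] by simp
qed

text \<open>
  The exponents of the numerator are, in decreasing order, \<open>m + n\<close>, then \<open>n, \<dots>, n - k + 1\<close> (the list \<open>ys\<close> of
  nodes), then \<open>n - k - 1, \<dots>, 0\<close> (the list \<open>zs\<close>).  In the denominator \<open>m + n\<close> is missing, and \<open>d = n - k\<close> stands between the
  two lists.
\<close>

lemma schur_hook:
  assumes "k \<le> n"
  shows "schur (Suc n) (m # replicate k 1 @ replicate (n - k) 0)
    = (\<Prod>i<n - k. (T i - T (m + n)) / (T i - T (n - k)))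
      * (\<Prod>a<k. (T (Suc a + (n - k)) - T (m + n)) / (T (n - k) - T (Suc a + (n - k))))"
proof -
  define d where "d = n - k"
  define ys where "ys = map (\<lambda>a. T (Suc a + d)) (rev [0..<k])"
  define zs where "zs = map T (rev [0..<d])"
  let ?lam = "m # replicate k 1 @ replicate d 0"
  have n: "n = k + d" using assms by (simp add: d_def)
  have num: "map (\<lambda>j. T (?lam ! j + (Suc n - 1 - j))) [0..<Suc n] = T (m + n) # ys @ zs"
    unfolding n ys_def zs_def
    by (rule nth_equalityI) (auto simp: nth_Cons nth_append rev_nth split: nat.splits
        intro!: arg_cong[of _ _ T] simp del: upt_Suc)
  have den: "map (\<lambda>j. T (replicate (Suc n) 0 ! j + (Suc n - 1 - j))) [0..<Suc n] = ys @ T d # zs"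
    unfolding n ys_def zs_def
    by (rule nth_equalityI) (auto simp: nth_Cons nth_append rev_nth split: nat.splits
        intro!: arg_cong[of _ _ T] simp del: upt_Suc replicate_Suc)
  have dist: "distinct (ys @ zs)"
    by (auto simp: ys_def zs_def distinct_map inj_on_def)
  have prod_ys: "(\<Prod>y\<leftarrow>ys. f y) = (\<Prod>a<k. f (T (Suc a + d)))" for f :: "ratfun \<Rightarrow> ratfun"
    by (simp add: ys_def rev_map[symmetric] o_def atLeast0LessThan prod.distinct_set_conv_list[symmetric])
  have prod_zs: "(\<Prod>z\<leftarrow>zs. f z) = (\<Prod>i<d. f (T i))" for f :: "ratfun \<Rightarrow> ratfun"
    by (simp add: zs_def rev_map[symmetric] o_def atLeast0LessThan prod.distinct_set_conv_list[symmetric])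
  have "schur (Suc n) ?lam = vandermonde_prod (T (m + n) # ys @ zs) / vandermonde_prod (ys @ T d # zs)"
    unfolding schur_def by (subst (1 2) det_alternant) (simp_all only: num den, simp_all add: n)
  also have "\<dots> = (\<Prod>y\<leftarrow>ys. y - T (m + n)) * (\<Prod>z\<leftarrow>zs. z - T (m + n)) /
      ((\<Prod>y\<leftarrow>ys. T d - y) * (\<Prod>z\<leftarrow>zs. z - T d))"
    using vandermonde_prod_nonzero[OF dist] by (simp add: vandermonde_prod_insert)
  also have "\<dots> = (\<Prod>i<d. (T i - T (m + n)) / (T i - T d))
      * (\<Prod>a<k. (T (Suc a + d) - T (m + n)) / (T d - T (Suc a + d)))"
    by (simp add: prod_ys prod_zs prod_dividef mult.commute)
  finally show ?thesis by (simp add: d_def)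
qed

theorem theorem11p3:
  fixes m n k :: nat
  assumes "m \<ge> 1" and "k \<le> n"
  shows "schur (n + 1) (m # replicate k 1 @ replicate (n - k) 0) =
    qt_binomial (m + n) (n - k) * (phi ^^ (n - k)) (ribbon (replicate k 1 @ [m]))"
proof -
  obtain M where m: "m = Suc M" using assms(1) by (cases m) auto
  have "(phi ^^ (n - k)) (ribbon (replicate k 1 @ [m]))
      = (\<Prod>a<k. (T (Suc a + (n - k)) - T (m + n)) / (T (n - k) - T (Suc a + (n - k))))"
    using assms unfolding m ribbon_hook phi_funpow_prod_ratio by (simp add: add.commute)
  moreover have "qt_binomial (m + n) (n - k) = (\<Prod>i<n - k. (T i - T (m + n)) / (T i - T (n - k)))"
    by (rule qt_binomial_eq) simp
  ultimately show ?thesis using schur_hook[OF assms(2), of m] by simp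
qed

end
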